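(* Let $M$ be a smooth manifold. The differential 1-forms $\alpha$ on $TM$ corresponding, as work forms, to relativistic fields are the same independently of the metric: for every non-degenerate pseudo-Riemannian metric $T_2$ on $M$, the set of work forms (with respect to $T_2$) of relativistic fields on $(M,T_2)$ is equal to the contact system $\Omega$ of $TM$.
   Context: All objects are smooth; $\pi\colon TM\to M$ is the tangent bundle. A second order differential equation on $M$ is a vector field $D$ on $TM$ such that $\pi_*(D_{v_a})=v_a$ for every $v_a\in TM$. A 1-form on $TM$ is horizontal if at each point $v_a\in T_aM$ it is the pull-back by $\pi$ of an element of $T_a^*M$. The contact system $\Omega$ on $TM$ consists of all 1-forms on $TM$ that annihilate every second order differential equation; its definition does not involve any metric. Equivalently, $\Omega$ consists of the horizontal 1-forms $\alpha$ such that $\dot\alpha=0$, where $\dot\alpha\colon TM\to\mathbb{R}$ is the function $\dot\alpha(v_a)=\langle\alpha_{v_a},v_a\rangle$ (with $\alpha_{v_a}$ regarded as an element of $T_a^*M$). Given a metric $T_2$, the kinetic energy is $T(v_a)=\tfrac12 T_2(v_a,v_a)$ on $TM$; the Liouville form $\theta$ on $TM$ is the 1-form with $\theta_{v_a}=\pi^*(i_{v_a}T_2)$, and $\omega_2=d\theta$ is a symplectic form on $TM$. It is known that the equation $i_D\omega_2+dT+\alpha=0$ establishes a one-to-one correspondence between second order differential equations $D$ and horizontal 1-forms $\alpha$ on $TM$; $\alpha$ is called the work form of $D$ with respect to $T_2$. A second order differential equation $D$ is called a relativistic field on $(M,T_2)$ if $DT=0$. *)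

theory Defs
  imports "HOL-Analysis.Analysis"
begin

section \<open>Smooth maps between Euclidean spaces\<close>

text \<open>All iterated directional derivatives up to order \<open>n\<close> exist and are continuous; for
  open \<open>S\<close> and a finite-dimensional domain this is \<open>C\<^sup>n\<close>.\<close>

primrec Ck_on :: "nat \<Rightarrow> 'e::euclidean_space set \<Rightarrow> ('e \<Rightarrow> 'f::real_normed_vector) \<Rightarrow> bool" where
  "Ck_on 0 S f \<longleftrightarrow> continuous_on S f"
| "Ck_on (Suc n) S f \<longleftrightarrow>
     (\<forall>x\<in>S. f differentiable (at x)) \<and> (\<forall>v. Ck_on n S (\<lambda>x. frechet_derivative f (at x) v))"

definition smooth_on :: "'e::euclidean_space set \<Rightarrow> ('e \<Rightarrow> 'f::real_normed_vector) \<Rightarrow> bool" where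
  "smooth_on S f \<longleftrightarrow> (\<forall>n. Ck_on n S f)"


section \<open>Smooth manifolds\<close>

text \<open>A chart is a domain together with a coordinate map, whose values off the domain are
  irrelevant. A manifold is given by an atlas, which need not be maximal; its underlying set is
  the union of the chart domains, and its topology is the one for which the charts are
  homeomorphisms onto their open images.\<close>

type_synonym ('a, 'e) chart = "'a set \<times> ('a \<Rightarrow> 'e)"

abbreviation chart_inv :: "('a, 'e) chart \<Rightarrow> 'e \<Rightarrow> 'a" where
  "chart_inv c \<equiv> inv_into (fst c) (snd c)"

definition carrier :: "('a, 'e) chart set \<Rightarrow> 'a set" where
  "carrier A = (\<Union>c\<in>A. fst c)"

definition charts_at :: "('a, 'e) chart set \<Rightarrow> 'a \<Rightarrow> ('a, 'e) chart set" where
  "charts_at A p = {c \<in> A. p \<in> fst c}"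

definition smooth_atlas :: "('a, 'e::euclidean_space) chart set \<Rightarrow> bool" where
  "smooth_atlas A \<longleftrightarrow>
     (\<forall>c\<in>A. inj_on (snd c) (fst c) \<and> open (snd c ` fst c)) \<and>
     (\<forall>c\<in>A. \<forall>d\<in>A. open (snd c ` (fst c \<inter> fst d)) \<and>
        smooth_on (snd c ` (fst c \<inter> fst d)) (snd d \<circ> chart_inv c))"

definition atlas_topology :: "('a, 'e::euclidean_space) chart set \<Rightarrow> 'a topology" where
  "atlas_topology A =
     topology (\<lambda>W. W \<subseteq> carrier A \<and> (\<forall>c\<in>A. open (snd c ` (W \<inter> fst c))))"

lemma openin_atlas_topology:
  assumes "smooth_atlas A"
  shows "openin (atlas_topology A) W \<longleftrightarrow>
    W \<subseteq> carrier A \<and> (\<forall>c\<in>A. open (snd c ` (W \<inter> fst c)))"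
proof -
  have "istopology (\<lambda>W. W \<subseteq> carrier A \<and> (\<forall>c\<in>A. open (snd c ` (W \<inter> fst c))))"
    unfolding istopology_def
  proof (intro conjI allI impI)
    fix S T
    assume S: "S \<subseteq> carrier A \<and> (\<forall>c\<in>A. open (snd c ` (S \<inter> fst c)))"
      and T: "T \<subseteq> carrier A \<and> (\<forall>c\<in>A. open (snd c ` (T \<inter> fst c)))"
    show "S \<inter> T \<subseteq> carrier A" using S by blast
    show "\<forall>c\<in>A. open (snd c ` (S \<inter> T \<inter> fst c))"
    proof
      fix c assume c: "c \<in> A"
      have "inj_on (snd c) (fst c)" using assms c by (auto simp: smooth_atlas_def)
      then have "snd c ` (S \<inter> T \<inter> fst c) = snd c ` (S \<inter> fst c) \<inter> snd c ` (T \<inter> fst c)"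
        by (auto simp: inj_on_def)
      then show "open (snd c ` (S \<inter> T \<inter> fst c))" using S T c by auto
    qed
  next
    fix K
    assume K: "\<forall>S\<in>K. S \<subseteq> carrier A \<and> (\<forall>c\<in>A. open (snd c ` (S \<inter> fst c)))"
    show "\<Union>K \<subseteq> carrier A" using K by blast
    show "\<forall>c\<in>A. open (snd c ` (\<Union>K \<inter> fst c))"
    proof
      fix c assume c: "c \<in> A"
      have "snd c ` (\<Union>K \<inter> fst c) = (\<Union>S\<in>K. snd c ` (S \<inter> fst c))" by blast
      then show "open (snd c ` (\<Union>K \<inter> fst c))" using K c by auto
    qed
  qed
  then show ?thesis by (simp add: atlas_topology_def topology_inverse')
qed

definition smooth_manifold :: "('a, 'e::euclidean_space) chart set \<Rightarrow> bool" where
  "smooth_manifold A \<longleftrightarrow> smooth_atlas A \<and>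
     Hausdorff_space (atlas_topology A) \<and> second_countable (atlas_topology A)"


section \<open>Tangent vectors\<close>

text \<open>A tangent vector at \<open>p\<close> is the family of its coordinate vectors in all the charts at
  \<open>p\<close>, related to each other by the derivatives of the changes of coordinates. The family is
  padded with \<open>0\<close> at other charts, so that equal tangent vectors are equal functions; the
  vector space operations are pointwise.\<close>

type_synonym ('a, 'e) tangent = "('a, 'e) chart \<Rightarrow> 'e"

definition tangent_space ::
    "('a, 'e::euclidean_space) chart set \<Rightarrow> 'a \<Rightarrow> ('a, 'e) tangent set" where
  "tangent_space A p = {v.
     (\<forall>c\<in>charts_at A p. \<forall>d\<in>charts_at A p.
        v d = frechet_derivative (snd d \<circ> chart_inv c) (at (snd c p)) (v c)) \<and>
     (\<forall>c. c \<notin> charts_at A p \<longrightarrow> v c = 0)}"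

text \<open>The tangent vector at \<open>p\<close> whose coordinates in the chart \<open>c\<close> are \<open>e\<close>.\<close>

definition coord_vector ::
    "('a, 'e::euclidean_space) chart set \<Rightarrow> ('a, 'e) chart \<Rightarrow> 'a \<Rightarrow> 'e \<Rightarrow> ('a, 'e) tangent" where
  "coord_vector A c p e = (\<lambda>d. if d \<in> charts_at A p
     then frechet_derivative (snd d \<circ> chart_inv c) (at (snd c p)) e else 0)"

text \<open>The tangent bundle, as an atlas: \<open>TM = carrier (tangent_bundle A)\<close> consists of the pairs
  \<open>(p, v)\<close> of a point and a tangent vector at it. It is again an atlas, to which all notions for
  manifolds apply; its points have type \<open>('a, 'e) tm\<close>, its tangent vectors type
  \<open>('a, 'e) ttm\<close>, and the projection onto \<open>M\<close> is \<open>fst\<close>.\<close>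

type_synonym ('a, 'e) tm = "'a \<times> ('a, 'e) tangent"
type_synonym ('a, 'e) ttm = "(('a, 'e) tm, 'e \<times> 'e) tangent"

definition tangent_bundle ::
    "('a, 'e::euclidean_space) chart set \<Rightarrow> (('a, 'e) tm, 'e \<times> 'e) chart set" where
  "tangent_bundle A =
     (\<lambda>c. ({(p, v). p \<in> fst c \<and> v \<in> tangent_space A p}, \<lambda>(p, v). (snd c p, v c))) ` A"

text \<open>The differentials below are computed in some chart at the point; for smooth arguments
  the result does not depend on it.\<close>

definition chart_of :: "('a, 'e) chart set \<Rightarrow> 'a \<Rightarrow> ('a, 'e) chart" where
  "chart_of A p = (SOME c. c \<in> charts_at A p)"

definition tangent_map ::
    "('a, 'e::euclidean_space) chart set \<Rightarrow> ('b, 'f::euclidean_space) chart set \<Rightarrow>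
     ('a \<Rightarrow> 'b) \<Rightarrow> 'a \<Rightarrow> ('a, 'e) tangent \<Rightarrow> ('b, 'f) tangent" where
  "tangent_map A B f p v = (\<lambda>d. if d \<in> charts_at B (f p)
     then (let c = chart_of A p in
       frechet_derivative (snd d \<circ> f \<circ> chart_inv c) (at (snd c p)) (v c))
     else 0)"


section \<open>Vector fields and differential forms\<close>

text \<open>Values of a vector field off the manifold are irrelevant.\<close>

definition vector_field ::
    "('a, 'e::euclidean_space) chart set \<Rightarrow> ('a \<Rightarrow> ('a, 'e) tangent) \<Rightarrow> bool" where
  "vector_field A X \<longleftrightarrow>
     (\<forall>p\<in>carrier A. X p \<in> tangent_space A p) \<and>
     (\<forall>c\<in>A. smooth_on (snd c ` fst c) (\<lambda>x. X (chart_inv c x) c))"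

definition covector ::
    "('a, 'e::euclidean_space) chart set \<Rightarrow> 'a \<Rightarrow> (('a, 'e) tangent \<Rightarrow> real) \<Rightarrow> bool" where
  "covector A p \<beta> \<longleftrightarrow>
     (\<forall>u\<in>tangent_space A p. \<forall>v\<in>tangent_space A p. \<beta> (\<lambda>c. u c + v c) = \<beta> u + \<beta> v) \<and>
     (\<forall>r. \<forall>u\<in>tangent_space A p. \<beta> (\<lambda>c. r *\<^sub>R u c) = r * \<beta> u)"

text \<open>Forms are padded with \<open>0\<close> where they are not defined, so that equal forms are equal
  functions.\<close>

definition one_form ::
    "('a, 'e::euclidean_space) chart set \<Rightarrow> ('a \<Rightarrow> ('a, 'e) tangent \<Rightarrow> real) \<Rightarrow> bool" where
  "one_form A \<alpha> \<longleftrightarrow>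
     (\<forall>p\<in>carrier A. covector A p (\<alpha> p)) \<and>
     (\<forall>c\<in>A. \<forall>e. smooth_on (snd c ` fst c)
        (\<lambda>x. \<alpha> (chart_inv c x) (coord_vector A c (chart_inv c x) e))) \<and>
     (\<forall>p v. \<not> (p \<in> carrier A \<and> v \<in> tangent_space A p) \<longrightarrow> \<alpha> p v = 0)"

definition differential ::
    "('a, 'e::euclidean_space) chart set \<Rightarrow> ('a \<Rightarrow> real) \<Rightarrow> 'a \<Rightarrow> ('a, 'e) tangent \<Rightarrow> real" where
  "differential A f p v =
     (let c = chart_of A p in frechet_derivative (f \<circ> chart_inv c) (at (snd c p)) (v c))"

text \<open>In coordinates \<open>d\<alpha>(u, w) = D\<^sub>u (\<alpha>(w)) - D\<^sub>w (\<alpha>(u))\<close>, where \<open>u\<close> and \<open>w\<close> are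
  extended with constant coordinates.\<close>

definition exterior_derivative ::
    "('a, 'e::euclidean_space) chart set \<Rightarrow> ('a \<Rightarrow> ('a, 'e) tangent \<Rightarrow> real) \<Rightarrow>
     'a \<Rightarrow> ('a, 'e) tangent \<Rightarrow> ('a, 'e) tangent \<Rightarrow> real" where
  "exterior_derivative A \<alpha> p u w =
     (let c = chart_of A p;
          a = (\<lambda>e x. \<alpha> (chart_inv c x) (coord_vector A c (chart_inv c x) e))
      in frechet_derivative (a (w c)) (at (snd c p)) (u c)
         - frechet_derivative (a (u c)) (at (snd c p)) (w c))"


section \<open>Pseudo-Riemannian metrics\<close>

definition pseudo_riemannian_metric ::
    "('a, 'e::euclidean_space) chart set \<Rightarrow>
     ('a \<Rightarrow> ('a, 'e) tangent \<Rightarrow> ('a, 'e) tangent \<Rightarrow> real) \<Rightarrow> bool" where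
  "pseudo_riemannian_metric A g \<longleftrightarrow>
     (\<forall>p\<in>carrier A.
        (\<forall>u\<in>tangent_space A p. covector A p (g p u)) \<and>
        (\<forall>u\<in>tangent_space A p. \<forall>v\<in>tangent_space A p. g p u v = g p v u) \<and>
        (\<forall>u\<in>tangent_space A p. (\<forall>v\<in>tangent_space A p. g p u v = 0) \<longrightarrow> u = (\<lambda>c. 0))) \<and>
     (\<forall>c\<in>A. \<forall>e e'. smooth_on (snd c ` fst c)
        (\<lambda>x. g (chart_inv c x) (coord_vector A c (chart_inv c x) e)
                               (coord_vector A c (chart_inv c x) e')))"

definition kinetic_energy ::
    "('a \<Rightarrow> ('a, 'e) tangent \<Rightarrow> ('a, 'e) tangent \<Rightarrow> real) \<Rightarrow> ('a, 'e) tm \<Rightarrow> real" where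
  "kinetic_energy g = (\<lambda>(p, v). g p v v / 2)"

definition liouville_form ::
    "('a, 'e::euclidean_space) chart set \<Rightarrow>
     ('a \<Rightarrow> ('a, 'e) tangent \<Rightarrow> ('a, 'e) tangent \<Rightarrow> real) \<Rightarrow>
     ('a, 'e) tm \<Rightarrow> ('a, 'e) ttm \<Rightarrow> real" where
  "liouville_form A g = (\<lambda>(p, v) w. g p v (tangent_map (tangent_bundle A) A fst (p, v) w))"

definition symplectic_form ::
    "('a, 'e::euclidean_space) chart set \<Rightarrow>
     ('a \<Rightarrow> ('a, 'e) tangent \<Rightarrow> ('a, 'e) tangent \<Rightarrow> real) \<Rightarrow>
     ('a, 'e) tm \<Rightarrow> ('a, 'e) ttm \<Rightarrow> ('a, 'e) ttm \<Rightarrow> real" where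
  "symplectic_form A g = exterior_derivative (tangent_bundle A) (liouville_form A g)"


section \<open>Second order differential equations\<close>

definition second_order_de ::
    "('a, 'e::euclidean_space) chart set \<Rightarrow> (('a, 'e) tm \<Rightarrow> ('a, 'e) ttm) \<Rightarrow> bool" where
  "second_order_de A D \<longleftrightarrow> vector_field (tangent_bundle A) D \<and>
     (\<forall>(p, v)\<in>carrier (tangent_bundle A).
        tangent_map (tangent_bundle A) A fst (p, v) (D (p, v)) = v)"

definition horizontal ::
    "('a, 'e::euclidean_space) chart set \<Rightarrow> (('a, 'e) tm \<Rightarrow> ('a, 'e) ttm \<Rightarrow> real) \<Rightarrow> bool" where
  "horizontal A \<alpha> \<longleftrightarrow>
     (\<forall>(p, v)\<in>carrier (tangent_bundle A). \<exists>\<beta>. covector A p \<beta> \<and>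
        (\<forall>w\<in>tangent_space (tangent_bundle A) (p, v).
           \<alpha> (p, v) w = \<beta> (tangent_map (tangent_bundle A) A fst (p, v) w)))"

definition contact_system ::
    "('a, 'e::euclidean_space) chart set \<Rightarrow> (('a, 'e) tm \<Rightarrow> ('a, 'e) ttm \<Rightarrow> real) set" where
  "contact_system A = {\<alpha>. one_form (tangent_bundle A) \<alpha> \<and>
     (\<forall>D. second_order_de A D \<longrightarrow> (\<forall>q\<in>carrier (tangent_bundle A). \<alpha> q (D q) = 0))}"

definition work_form ::
    "('a, 'e::euclidean_space) chart set \<Rightarrow>
     ('a \<Rightarrow> ('a, 'e) tangent \<Rightarrow> ('a, 'e) tangent \<Rightarrow> real) \<Rightarrow>
     (('a, 'e) tm \<Rightarrow> ('a, 'e) ttm) \<Rightarrow> (('a, 'e) tm \<Rightarrow> ('a, 'e) ttm \<Rightarrow> real) \<Rightarrow> bool" where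
  "work_form A g D \<alpha> \<longleftrightarrow> one_form (tangent_bundle A) \<alpha> \<and> horizontal A \<alpha> \<and>
     (\<forall>q\<in>carrier (tangent_bundle A). \<forall>w\<in>tangent_space (tangent_bundle A) q.
        symplectic_form A g q (D q) w
          + differential (tangent_bundle A) (kinetic_energy g) q w + \<alpha> q w = 0)"

definition relativistic_field ::
    "('a, 'e::euclidean_space) chart set \<Rightarrow>
     ('a \<Rightarrow> ('a, 'e) tangent \<Rightarrow> ('a, 'e) tangent \<Rightarrow> real) \<Rightarrow>
     (('a, 'e) tm \<Rightarrow> ('a, 'e) ttm) \<Rightarrow> bool" where
  "relativistic_field A g D \<longleftrightarrow> second_order_de A D \<and>
     (\<forall>q\<in>carrier (tangent_bundle A).
        differential (tangent_bundle A) (kinetic_energy g) q (D q) = 0)"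

end

theory Submission imports Defs begin

text \<open>
  A work form of a second order equation \<open>D\<close> satisfies \<open>\<alpha>(D) = - DT\<close>, since \<open>\<omega>\<^sub>2(D, D) = 0\<close>; so \<open>D\<close> is
  relativistic exactly when \<open>\<alpha>(D) = 0\<close>. As \<open>\<alpha>\<close> is horizontal and all second order equations have the
  same projection at \<open>v\<close>, namely \<open>v\<close>, \<open>\<alpha>\<close> then annihilates every one of them. Conversely, a 1-form that
  annihilates all second order equations annihilates their differences, and bump functions give every
  vertical vector, up to a factor, as such a difference; hence the form is horizontal. Every horizontal
  form is the work form of some \<open>D\<close>: in each chart of \<open>TM\<close> the acceleration is the unique solution of a
  linear system whose matrix is the metric, and the solutions in two charts agree because the second
  derivatives of the change of coordinates are symmetric.
\<close>

section \<open>Calculus of smooth maps\<close>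

text \<open>Adding vertical fields needs one second order equation to start from; the metric
  supplies it. A bump function in a chart extends by 0 to a smooth field only if its support is
  closed in the whole manifold, and this is where the Hausdorff axiom enters: compact sets are
  closed. \<open>Ck_on\<close> differentiates in fixed directions, whereas the coordinate formulas
  apply derivatives and metrics to varying vectors. Expanding in \<open>Basis\<close> turns such
  expressions into finite sums of products of smooth functions. The smoothness of the acceleration
  is obtained without determinants. If L F = R, then formally L F' = R' - L' F, a system with the
  same L; so the order of differentiability of F rises by induction, once F is known to be
  continuous. Differentials are computed in a chart picked by choice, so formulas are proved in that
  chart and then carried to the others by explicit transformation laws.\<close>

lemma Ck_on_has_derivative:
  "Ck_on (Suc n) S f \<Longrightarrow> x \<in> S \<Longrightarrow> (f has_derivative frechet_derivative f (at x)) (at x)"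
  by (simp add: frechet_derivative_works)

lemma Ck_on_SucI:
  assumes "\<And>x. x \<in> S \<Longrightarrow> (f has_derivative f' x) (at x)"
    and "\<And>v. Ck_on n S (\<lambda>x. frechet_derivative f (at x) v)"
  shows "Ck_on (Suc n) S f"
  using assms by (auto simp: differentiable_def)

lemma Ck_on_subset: "Ck_on n S f \<Longrightarrow> T \<subseteq> S \<Longrightarrow> Ck_on n T f"
  by (induction n arbitrary: f) (auto intro: continuous_on_subset)

lemma Ck_on_cong:
  assumes "open S" "\<And>x. x \<in> S \<Longrightarrow> f x = g x" "Ck_on n S f"
  shows "Ck_on n S g"
  using assms(2,3)
proof (induction n arbitrary: f g)
  case 0
  then show ?case by (simp cong: continuous_on_cong)
next
  case (Suc n)
  have d: "(g has_derivative frechet_derivative f (at x)) (at x)" if "x \<in> S" for x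
    using Ck_on_has_derivative[OF Suc.prems(2) that] assms(1) that Suc.prems(1)
    by (rule has_derivative_transform_within_open)
  show ?case
  proof (rule Ck_on_SucI[OF d])
    fix v
    show "Ck_on n S (\<lambda>x. frechet_derivative g (at x) v)"
    proof (rule Suc.IH)
      show "Ck_on n S (\<lambda>x. frechet_derivative f (at x) v)" using Suc.prems(2) by simp
      fix x assume "x \<in> S"
      from frechet_derivative_at[OF d[OF this]]
      show "frechet_derivative f (at x) v = frechet_derivative g (at x) v" by simp
    qed
  qed
qed

text \<open>Lets an explicit derivative stand in for \<open>frechet_derivative\<close>; the closure
  proofs below raise the order by this rule.\<close>

lemma Ck_on_SucI':
  assumes "open S" "\<And>x. x \<in> S \<Longrightarrow> (f has_derivative f' x) (at x)"
    and "\<And>v. Ck_on n S (\<lambda>x. f' x v)"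
  shows "Ck_on (Suc n) S f"
proof (rule Ck_on_SucI[OF assms(2)])
  fix v
  show "Ck_on n S (\<lambda>x. frechet_derivative f (at x) v)"
    by (rule Ck_on_cong[OF assms(1) _ assms(3)[of v]]) (use frechet_derivative_at[OF assms(2)] in simp)
qed

lemma Ck_on_imp_continuous: "Ck_on n S f \<Longrightarrow> continuous_on S f"
proof (induction n)
  case (Suc n)
  then show ?case
    by (auto intro!: continuous_at_imp_continuous_on differentiable_imp_continuous_within)
qed simp

lemma Ck_on_Suc_imp: "Ck_on (Suc n) S f \<Longrightarrow> Ck_on n S f"
proof (induction n arbitrary: f)
  case 0
  then show ?case using Ck_on_imp_continuous[of 1] by simp
next
  case (Suc n)
  have "Ck_on n S (\<lambda>x. frechet_derivative f (at x) v)" for v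
    using Suc.prems by (intro Suc.IH) simp
  then show ?case using Suc.prems by simp
qed

text \<open>Allows a function to be glued from different formulas on overlapping open sets, as is
  done for fields extended by 0.\<close>

lemma Ck_on_local:
  assumes "\<And>x. x \<in> S \<Longrightarrow> \<exists>T. open T \<and> x \<in> T \<and> Ck_on n T f"
  shows "Ck_on n S f"
  using assms
proof (induction n arbitrary: f)
  case 0
  show ?case unfolding Ck_on.simps
  proof (rule continuous_at_imp_continuous_on, rule ballI)
    fix x assume "x \<in> S"
    then obtain T where "open T" "x \<in> T" "continuous_on T f" using 0[of x] by auto
    then show "isCont f x" using continuous_on_eq_continuous_at by blast
  qed
next
  case (Suc n)
  have "f differentiable (at x)" if "x \<in> S" for x
    using Suc.prems[OF that] by auto
  moreover have "Ck_on n S (\<lambda>x. frechet_derivative f (at x) v)" for v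
  proof (rule Suc.IH)
    fix x assume "x \<in> S"
    from Suc.prems[OF this] show "\<exists>T. open T \<and> x \<in> T \<and> Ck_on n T (\<lambda>x. frechet_derivative f (at x) v)"
      by auto
  qed
  ultimately show ?case by simp
qed

lemma Ck_on_const: "Ck_on n S (\<lambda>x. c)"
  by (induction n arbitrary: c) auto

lemma Ck_on_bounded_linear:
  assumes "bounded_linear f"
  shows "Ck_on n S f"
proof (cases n)
  case (Suc m)
  have "(f has_derivative f) (at x)" for x
    by (rule bounded_linear_imp_has_derivative[OF assms])
  then have "frechet_derivative f (at x) = f" for x
    using frechet_derivative_at by metis
  then show ?thesis using Suc assms
    by (simp add: Ck_on_const bounded_linear_imp_differentiable)
qed (simp add: assms linear_continuous_on)

lemma Ck_on_compose_linear:
  assumes "bounded_linear h" "open S" "Ck_on n S f"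
  shows "Ck_on n S (\<lambda>x. h (f x))"
  using assms(3)
proof (induction n arbitrary: f)
  case 0
  then show ?case using bounded_linear.continuous_on[OF assms(1)] by simp
next
  case (Suc n)
  show ?case
    using Suc.prems
    by (intro Ck_on_SucI'[OF assms(2) bounded_linear.has_derivative[OF assms(1) Ck_on_has_derivative[OF Suc.prems]]] Suc.IH)
      simp_all
qed

lemma Ck_on_add:
  assumes "open S" "Ck_on n S f" "Ck_on n S g"
  shows "Ck_on n S (\<lambda>x. f x + g x)"
  using assms(2,3)
proof (induction n arbitrary: f g)
  case 0
  then show ?case by (simp add: continuous_on_add)
next
  case (Suc n)
  show ?case
    using Suc.prems
    by (intro Ck_on_SucI'[OF assms(1) has_derivative_add[OF Suc.prems[THEN Ck_on_has_derivative]]] Suc.IH)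
      simp_all
qed

lemma Ck_on_sum:
  assumes "open S" "\<And>i. i \<in> I \<Longrightarrow> Ck_on n S (f i)"
  shows "Ck_on n S (\<lambda>x. \<Sum>i\<in>I. f i x)"
  using assms(2) by (induction I rule: infinite_finite_induct) (auto simp: Ck_on_const Ck_on_add assms(1))

text \<open>The product rule gives two products in which one factor is differentiated, so the
  induction generalises over both factors; the other factor is lowered to the same order.\<close>

lemma Ck_on_bilinear:
  assumes "bounded_bilinear h" "open S" "Ck_on n S f" "Ck_on n S g"
  shows "Ck_on n S (\<lambda>x. h (f x) (g x))"
  using assms(3,4)
proof (induction n arbitrary: f g)
  case 0
  then show ?case using bounded_bilinear.continuous_on[OF assms(1)] by simp
next
  case (Suc n)
  have "Ck_on n S (\<lambda>x. frechet_derivative f (at x) v)"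
    "Ck_on n S (\<lambda>x. frechet_derivative g (at x) v)" for v
    using Suc.prems by auto
  then have "Ck_on n S (\<lambda>x. h (f x) (frechet_derivative g (at x) v) + h (frechet_derivative f (at x) v) (g x))" for v
    using Suc.prems[THEN Ck_on_Suc_imp] by (intro Ck_on_add Suc.IH assms(2))
  then show ?case
    using bounded_bilinear.FDERIV[OF assms(1) Suc.prems[THEN Ck_on_has_derivative]]
    by (intro Ck_on_SucI'[OF assms(2)])
qed

lemmas Ck_on_scaleR = Ck_on_bilinear[OF bounded_bilinear_scaleR]
lemmas Ck_on_inner = Ck_on_bilinear[OF bounded_bilinear_inner]
lemmas Ck_on_mult = Ck_on_bilinear[OF bounded_bilinear_mult]

lemma linear_basis_expansion:
  fixes L :: "'e::euclidean_space \<Rightarrow> 'f::real_vector"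
  assumes "linear L"
  shows "L v = (\<Sum>b\<in>Basis. (v \<bullet> b) *\<^sub>R L b)"
proof -
  have "L v = L (\<Sum>b\<in>Basis. (v \<bullet> b) *\<^sub>R b)" by (simp add: euclidean_representation)
  also have "\<dots> = (\<Sum>b\<in>Basis. (v \<bullet> b) *\<^sub>R L b)"
    by (simp only: linear_sum[OF assms] linear_cmul[OF assms])
  finally show ?thesis .
qed

text \<open>The chain rule differentiates \<open>g\<close> in the direction of the derivative of
  \<open>f\<close>, which depends on \<open>x\<close>. The induction hypothesis speaks of fixed
  directions, so that direction is first expanded in \<open>Basis\<close>.\<close>

lemma Ck_on_compose:
  fixes f :: "'e::euclidean_space \<Rightarrow> 'h::euclidean_space" and g :: "'h \<Rightarrow> 'f::real_normed_vector"
  assumes "open S" "Ck_on n S f" "Ck_on n T g" "f ` S \<subseteq> T"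
  shows "Ck_on n S (\<lambda>x. g (f x))"
  using assms(2,3)
proof (induction n arbitrary: g)
  case 0
  then show ?case using assms(4) continuous_on_compose2[of T g S f] by simp
next
  case (Suc n)
  have g: "(g has_derivative frechet_derivative g (at (f x))) (at (f x))" if "x \<in> S" for x
    using Ck_on_has_derivative[OF Suc.prems(2), of "f x"] that assms(4) by auto
  have d: "((\<lambda>x. g (f x)) has_derivative
      (\<lambda>v. \<Sum>b\<in>Basis. (frechet_derivative f (at x) v \<bullet> b) *\<^sub>R frechet_derivative g (at (f x)) b)) (at x)"
    if "x \<in> S" for x
  proof -
    have "(\<Sum>b\<in>Basis. (frechet_derivative f (at x) v \<bullet> b) *\<^sub>R frechet_derivative g (at (f x)) b)
        = frechet_derivative g (at (f x)) (frechet_derivative f (at x) v)" for v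
      by (rule linear_basis_expansion[OF has_derivative_linear[OF g[OF that]], symmetric])
    then show ?thesis
      using diff_chain_at[OF Ck_on_has_derivative[OF Suc.prems(1) that] g[OF that]]
      by (simp add: o_def)
  qed
  show ?case
  proof (rule Ck_on_SucI'[OF assms(1) d])
    fix v
    show "Ck_on n S (\<lambda>x. \<Sum>b\<in>Basis. (frechet_derivative f (at x) v \<bullet> b) *\<^sub>R frechet_derivative g (at (f x)) b)"
    proof (intro Ck_on_sum Ck_on_scaleR Ck_on_inner assms(1) Ck_on_const)
      show "Ck_on n S (\<lambda>x. frechet_derivative f (at x) v)" using Suc.prems(1) by simp
      show "Ck_on n S (\<lambda>x. frechet_derivative g (at (f x)) b)" for b
        by (rule Suc.IH[OF Ck_on_Suc_imp[OF Suc.prems(1)]]) (use Suc.prems(2) in simp)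
    qed
  qed
qed

lemma Ck_on_Pair:
  assumes "open S" "Ck_on n S f" "Ck_on n S g"
  shows "Ck_on n S (\<lambda>x. (f x, g x))"
  using Ck_on_add[OF assms(1)
      Ck_on_compose_linear[OF bounded_linear_Pair[OF bounded_linear_ident bounded_linear_zero] assms(1,2)]
      Ck_on_compose_linear[OF bounded_linear_Pair[OF bounded_linear_zero bounded_linear_ident] assms(1,3)]]
  by simp

section \<open>The closure properties for smooth maps\<close>

lemma smooth_onD_Ck_on: "smooth_on S f \<Longrightarrow> Ck_on n S f"
  by (simp add: smooth_on_def)

lemma smooth_on_has_derivative:
  "smooth_on S f \<Longrightarrow> x \<in> S \<Longrightarrow> (f has_derivative frechet_derivative f (at x)) (at x)"
  using Ck_on_has_derivative smooth_onD_Ck_on by blast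

lemma smooth_on_differentiable: "smooth_on S f \<Longrightarrow> x \<in> S \<Longrightarrow> f differentiable (at x)"
  using smooth_on_has_derivative differentiable_def by blast

lemma smooth_on_linear_derivative: "smooth_on S f \<Longrightarrow> x \<in> S \<Longrightarrow> linear (frechet_derivative f (at x))"
  using smooth_on_has_derivative has_derivative_linear by blast

lemma smooth_on_continuous_on: "smooth_on S f \<Longrightarrow> continuous_on S f"
  using smooth_onD_Ck_on Ck_on_imp_continuous by blast

lemma smooth_on_frechet_derivative: "smooth_on S f \<Longrightarrow> smooth_on S (\<lambda>x. frechet_derivative f (at x) v)"
  unfolding smooth_on_def using Ck_on.simps(2) by blast

lemma smooth_on_cong: "open S \<Longrightarrow> smooth_on S f \<Longrightarrow> (\<And>x. x \<in> S \<Longrightarrow> f x = g x) \<Longrightarrow> smooth_on S g"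
  unfolding smooth_on_def using Ck_on_cong by blast

lemma smooth_on_local:
  "(\<And>x. x \<in> S \<Longrightarrow> \<exists>T. open T \<and> x \<in> T \<and> smooth_on T f) \<Longrightarrow> smooth_on S f"
  unfolding smooth_on_def using Ck_on_local by metis

lemma smooth_on_const [intro, simp]: "smooth_on S (\<lambda>x. c)"
  by (simp add: smooth_on_def Ck_on_const)

lemma smooth_on_bounded_linear: "bounded_linear f \<Longrightarrow> smooth_on S f"
  by (simp add: smooth_on_def Ck_on_bounded_linear)

lemma smooth_on_compose_linear:
  "bounded_linear h \<Longrightarrow> open S \<Longrightarrow> smooth_on S f \<Longrightarrow> smooth_on S (\<lambda>x. h (f x))"
  by (simp add: smooth_on_def Ck_on_compose_linear)

lemma smooth_on_add:
  "open S \<Longrightarrow> smooth_on S f \<Longrightarrow> smooth_on S g \<Longrightarrow> smooth_on S (\<lambda>x. f x + g x)"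
  by (simp add: smooth_on_def Ck_on_add)

lemma smooth_on_sum:
  "open S \<Longrightarrow> (\<And>i. i \<in> I \<Longrightarrow> smooth_on S (f i)) \<Longrightarrow> smooth_on S (\<lambda>x. \<Sum>i\<in>I. f i x)"
  by (simp add: smooth_on_def Ck_on_sum)

lemma smooth_on_scaleR:
  "open S \<Longrightarrow> smooth_on S f \<Longrightarrow> smooth_on S g \<Longrightarrow> smooth_on S (\<lambda>x. f x *\<^sub>R g x)"
  by (simp add: smooth_on_def Ck_on_scaleR)

lemma smooth_on_mult:
  fixes f g :: "'e::euclidean_space \<Rightarrow> real"
  shows "open S \<Longrightarrow> smooth_on S f \<Longrightarrow> smooth_on S g \<Longrightarrow> smooth_on S (\<lambda>x. f x * g x)"
  by (simp add: smooth_on_def Ck_on_mult)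

lemma smooth_on_inner:
  "open S \<Longrightarrow> smooth_on S f \<Longrightarrow> smooth_on S g \<Longrightarrow> smooth_on S (\<lambda>x. f x \<bullet> g x)"
  by (simp add: smooth_on_def Ck_on_inner)

lemma smooth_on_diff:
  "open S \<Longrightarrow> smooth_on S f \<Longrightarrow> smooth_on S g \<Longrightarrow> smooth_on S (\<lambda>x. f x - g x)"
  using smooth_on_add[of S f "\<lambda>x. - g x"] smooth_on_compose_linear[OF bounded_linear_minus[OF bounded_linear_ident], of S g]
  by simp

lemma smooth_on_compose:
  fixes f :: "'e::euclidean_space \<Rightarrow> 'h::euclidean_space"
  shows "open S \<Longrightarrow> smooth_on S f \<Longrightarrow> smooth_on T g \<Longrightarrow> f ` S \<subseteq> T \<Longrightarrow> smooth_on S (\<lambda>x. g (f x))"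
  by (auto simp: smooth_on_def intro: Ck_on_compose)

lemma smooth_on_Pair:
  "open S \<Longrightarrow> smooth_on S f \<Longrightarrow> smooth_on S g \<Longrightarrow> smooth_on S (\<lambda>x. (f x, g x))"
  by (simp add: smooth_on_def Ck_on_Pair)

lemma smooth_on_fst: "smooth_on S fst" and smooth_on_snd: "smooth_on S snd"
  by (simp_all add: smooth_on_bounded_linear bounded_linear_fst bounded_linear_snd)

lemma smooth_on_id: "smooth_on S (\<lambda>x. x)"
  by (simp add: smooth_on_bounded_linear)

lemmas smooth_on_intros = smooth_on_add smooth_on_sum smooth_on_diff smooth_on_scaleR smooth_on_mult
  smooth_on_inner smooth_on_Pair smooth_on_fst smooth_on_snd smooth_on_id

section \<open>Symmetry of second derivatives\<close>

text \<open>Two applications of the mean value theorem: along \<open>u\<close> to the difference of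
  \<open>f\<close> on opposite sides of the parallelogram, then along \<open>v\<close> to the
  derivative so obtained. The left side is symmetric in \<open>u\<close> and \<open>v\<close>,
  although the right side is not visibly so.\<close>

lemma second_difference_mean_value:
  fixes f :: "'e::euclidean_space \<Rightarrow> real"
  assumes f: "smooth_on S f" and t: "t > 0"
    and S: "\<And>s r. s \<in> {0..t} \<Longrightarrow> r \<in> {0..t} \<Longrightarrow> x + s *\<^sub>R u + r *\<^sub>R v \<in> S"
  shows "\<exists>s\<in>{0..t}. \<exists>r\<in>{0..t}. f (x + t *\<^sub>R u + t *\<^sub>R v) - f (x + t *\<^sub>R u) - f (x + t *\<^sub>R v) + f x
    = t * t * frechet_derivative (\<lambda>y. frechet_derivative f (at y) u) (at (x + s *\<^sub>R u + r *\<^sub>R v)) v"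
proof -
  define p where "p s r = x + s *\<^sub>R u + r *\<^sub>R v" for s r
  have p0: "p s 0 = x + s *\<^sub>R u" for s by (simp add: p_def)
  let ?u = "\<lambda>y. frechet_derivative f (at y) u"
  have line: "((\<lambda>s. h (y + s *\<^sub>R w)) has_derivative (\<lambda>k. k * frechet_derivative h (at (y + s *\<^sub>R w)) w)) (at s within T)"
    if h: "smooth_on S h" and y: "y + s *\<^sub>R w \<in> S" for h :: "'e \<Rightarrow> real" and y w s T
  proof -
    have "((\<lambda>s. y + s *\<^sub>R w) has_derivative (\<lambda>k. k *\<^sub>R w)) (at s)"
      by (auto intro!: derivative_eq_intros)
    from diff_chain_at[OF this smooth_on_has_derivative[OF h y]]
    show ?thesis
      by (auto simp: o_def linear_cmul[OF smooth_on_linear_derivative[OF h y]] intro: has_derivative_at_withinI)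
  qed
  have ps: "p s r = (x + r *\<^sub>R v) + s *\<^sub>R u" for s r by (simp add: p_def)
  have "((\<lambda>s. f (p s t) - f (p s 0)) has_derivative (\<lambda>k. k * ?u (p s t) - k * ?u (p s 0))) (at s within {0..t})"
    if "0 \<le> s" "s \<le> t" for s
    unfolding ps using that t S[of s t] S[of s 0]
    by (intro has_derivative_diff line[OF f]) (simp_all add: algebra_simps)
  from mvt_very_simple[OF less_imp_le[OF t] this]
  obtain s where s: "s \<in> {0..t}" and
    1: "f (p t t) - f (p t 0) - (f (p 0 t) - f (p 0 0)) = t * ?u (p s t) - t * ?u (p s 0)"
    by auto
  have "((\<lambda>r. ?u (p s r)) has_derivative (\<lambda>k. k * frechet_derivative ?u (at (p s r)) v)) (at r within {0..t})"
    if "0 \<le> r" "r \<le> t" for r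
    unfolding p_def using that s S[of s r]
    by (intro line smooth_on_frechet_derivative f) simp_all
  from mvt_very_simple[OF less_imp_le[OF t] this]
  obtain r where r: "r \<in> {0..t}" and
    2: "?u (p s t) - ?u (p s 0) = t * frechet_derivative ?u (at (p s r)) v"
    by auto
  have "f (p t t) - f (p t 0) - f (p 0 t) + f (p 0 0) = t * (?u (p s t) - ?u (p s 0))"
    using 1 by (simp add: algebra_simps)
  also have "\<dots> = t * t * frechet_derivative ?u (at (p s r)) v" by (simp add: 2)
  finally have "f (p t t) - f (p t 0) - f (p 0 t) + f (p 0 0) = t * t * frechet_derivative ?u (at (p s r)) v" .
  then show ?thesis using s r by (auto simp: p_def intro!: bexI)
qed

text \<open>The second difference equals \<open>t * t\<close> times either mixed derivative, each at
  its own point of a small parallelogram. By continuity both values are close to those at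
  \<open>x\<close>.\<close>

lemma second_derivative_symmetric_real:
  fixes f :: "'e::euclidean_space \<Rightarrow> real"
  assumes S: "open S" and f: "smooth_on S f" and x: "x \<in> S"
  shows "frechet_derivative (\<lambda>y. frechet_derivative f (at y) u) (at x) v
    = frechet_derivative (\<lambda>y. frechet_derivative f (at y) v) (at x) u"
proof (rule ccontr)
  define D where "D u v y = frechet_derivative (\<lambda>y. frechet_derivative f (at y) u) (at y) v" for u v y
  \<comment> \<open>Half the supposed gap: two errors smaller than this cannot close it.\<close>
  define e where "e = \<bar>D u v x - D v u x\<bar> / 2"
  assume "\<not> ?thesis"
  then have e: "e > 0" by (simp add: e_def D_def)
  have D: "smooth_on S (D u v)" for u v
    unfolding D_def by (intro smooth_on_frechet_derivative f)
  have lim: "\<forall>\<^sub>F y in nhds x. \<bar>D u v y - D u v x\<bar> < e" for u v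
  proof -
    have "isCont (D u v) x"
      using smooth_on_continuous_on[OF D] continuous_on_eq_continuous_at[OF S] x by blast
    then have "(D u v \<longlongrightarrow> D u v x) (nhds x)"
      unfolding isCont_def tendsto_at_iff_tendsto_nhds .
    from tendstoD[OF this e] show ?thesis by (simp add: dist_real_def)
  qed
  have "\<forall>\<^sub>F y in nhds x. y \<in> S \<and> \<bar>D u v y - D u v x\<bar> < e \<and> \<bar>D v u y - D v u x\<bar> < e"
    by (intro eventually_conj lim eventually_nhds_in_open S x)
  then obtain d where d: "d > 0" and
    dS: "\<And>y. dist y x < d \<Longrightarrow> y \<in> S \<and> \<bar>D u v y - D u v x\<bar> < e \<and> \<bar>D v u y - D v u x\<bar> < e"
    unfolding eventually_nhds_metric by blast
  \<comment> \<open>Keeps the parallelogram within distance \<open>d\<close> of \<open>x\<close>;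
    the summand 1 makes the denominator positive and the bound strict.\<close>
  define t where "t = d / (norm u + norm v + 1)"
  have nz: "norm u + norm v + 1 > 0" by (simp add: add_nonneg_pos)
  then have t: "t > 0" using d by (simp add: t_def)
  have near: "dist (x + s *\<^sub>R u + r *\<^sub>R v) x < d" if "s \<in> {0..t}" "r \<in> {0..t}" for s r
  proof -
    have "dist (x + s *\<^sub>R u + r *\<^sub>R v) x = norm (s *\<^sub>R u + r *\<^sub>R v)"
      by (simp add: dist_norm add.assoc)
    also have "\<dots> \<le> s * norm u + r * norm v"
      using norm_triangle_ineq[of "s *\<^sub>R u" "r *\<^sub>R v"] that by simp
    also have "\<dots> \<le> t * norm u + t * norm v"
      using that by (intro add_mono mult_right_mono) auto
    also have "\<dots> < t * (norm u + norm v + 1)" using t by (simp add: algebra_simps)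
    also have "\<dots> = d" using nz by (simp add: t_def)
    finally show ?thesis .
  qed
  obtain s r where sr: "s \<in> {0..t}" "r \<in> {0..t}"
    "f (x + t *\<^sub>R u + t *\<^sub>R v) - f (x + t *\<^sub>R u) - f (x + t *\<^sub>R v) + f x = t * t * D u v (x + s *\<^sub>R u + r *\<^sub>R v)"
    using second_difference_mean_value[OF f t, of x u v] dS near unfolding D_def by blast
  have near': "dist (x + s *\<^sub>R v + r *\<^sub>R u) x < d" if "s \<in> {0..t}" "r \<in> {0..t}" for s r
    using near[OF that(2,1)] by (simp add: ac_simps)
  obtain s' r' where sr': "s' \<in> {0..t}" "r' \<in> {0..t}"
    "f (x + t *\<^sub>R v + t *\<^sub>R u) - f (x + t *\<^sub>R v) - f (x + t *\<^sub>R u) + f x = t * t * D v u (x + s' *\<^sub>R v + r' *\<^sub>R u)"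
    using second_difference_mean_value[OF f t, of x v u] dS near' unfolding D_def by blast
  have "t * t * D u v (x + s *\<^sub>R u + r *\<^sub>R v) = t * t * D v u (x + s' *\<^sub>R v + r' *\<^sub>R u)"
    unfolding sr(3)[symmetric] sr'(3)[symmetric] by (simp add: ac_simps)
  then have "D u v (x + s *\<^sub>R u + r *\<^sub>R v) = D v u (x + s' *\<^sub>R v + r' *\<^sub>R u)"
    using t by simp
  moreover have "\<bar>D u v (x + s *\<^sub>R u + r *\<^sub>R v) - D u v x\<bar> < e"
    using dS near sr by blast
  moreover have "\<bar>D v u (x + s' *\<^sub>R v + r' *\<^sub>R u) - D v u x\<bar> < e"
    using dS near' sr' by blast
  ultimately show False unfolding e_def by (auto simp: field_simps abs_if split: if_splits)
qed

lemma frechet_derivative_bounded_linear_compose: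
  assumes "bounded_linear h" "f differentiable (at x)"
  shows "frechet_derivative (\<lambda>y. h (f y)) (at x) v = h (frechet_derivative f (at x) v)"
  using frechet_derivative_at[OF bounded_linear.has_derivative[OF assms(1)
        assms(2)[unfolded frechet_derivative_works]]] by metis

lemma second_derivative_symmetric:
  fixes f :: "'e::euclidean_space \<Rightarrow> 'f::euclidean_space"
  assumes S: "open S" and f: "smooth_on S f" and x: "x \<in> S"
  shows "frechet_derivative (\<lambda>y. frechet_derivative f (at y) u) (at x) v
    = frechet_derivative (\<lambda>y. frechet_derivative f (at y) v) (at x) u"
proof (rule euclidean_eqI)
  fix b :: 'f
  note bl = bounded_linear_inner_left[of b]
  have *: "frechet_derivative (\<lambda>y. frechet_derivative (\<lambda>z. f z \<bullet> b) (at y) u) (at x) v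
      = frechet_derivative (\<lambda>y. frechet_derivative f (at y) u) (at x) v \<bullet> b" for u v
  proof -
    have d: "((\<lambda>y. frechet_derivative f (at y) u \<bullet> b) has_derivative
        (\<lambda>v. frechet_derivative (\<lambda>y. frechet_derivative f (at y) u) (at x) v \<bullet> b)) (at x)"
      by (rule bounded_linear.has_derivative[OF bl smooth_on_has_derivative[OF smooth_on_frechet_derivative[OF f] x]])
    have "((\<lambda>y. frechet_derivative (\<lambda>z. f z \<bullet> b) (at y) u) has_derivative
        (\<lambda>v. frechet_derivative (\<lambda>y. frechet_derivative f (at y) u) (at x) v \<bullet> b)) (at x)"
      by (rule has_derivative_transform_within_open[OF d S x])
        (simp add: frechet_derivative_bounded_linear_compose[OF bl] smooth_on_differentiable[OF f])
    from frechet_derivative_at[OF this] show ?thesis by metis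
  qed
  show "frechet_derivative (\<lambda>y. frechet_derivative f (at y) u) (at x) v \<bullet> b
    = frechet_derivative (\<lambda>y. frechet_derivative f (at y) v) (at x) u \<bullet> b"
    using second_derivative_symmetric_real[OF S smooth_on_compose_linear[OF bl S f] x, of u v]
    unfolding * .
qed

section \<open>Smooth dependence of the solution of a linear system\<close>

text \<open>At a zero of \<open>f\<close> the product rule asks only for continuity of
  \<open>g\<close>: \<open>f y\<close> is of the order of \<open>y - x\<close> and
  \<open>g y - g x\<close> tends to 0, so the product of the two is negligible. This differentiates
  a solution of a linear system before it is known to be differentiable.\<close>

lemma has_derivative_bilinear_zero_factor:
  assumes "bounded_bilinear pr" and f: "(f has_derivative f') (at x)" "f x = 0" and g: "isCont g x"
  shows "((\<lambda>y. pr (f y) (g y)) has_derivative (\<lambda>h. pr (f' h) (g x))) (at x)"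
proof -
  interpret bounded_bilinear pr by fact
  obtain K where K: "K \<ge> 0" "\<And>a b. norm (pr a b) \<le> norm a * norm b * K"
    using nonneg_bounded by blast
  interpret f': bounded_linear f' by (rule has_derivative_bounded_linear[OF f(1)])
  obtain B where B: "\<And>h. norm (f' h) \<le> norm h * B"
    using f'.bounded by blast
  define r where "r y = norm (f y - f x - f' (y - x)) / norm (y - x)" for y
  have r: "(r \<longlongrightarrow> 0) (at x)"
    using f(1) unfolding has_derivative_iff_norm r_def by simp
  have "((\<lambda>y. (B + r y) * norm (g y - g x) * K) \<longlongrightarrow> (B + 0) * norm (g x - g x) * K) (at x)"
    using g unfolding isCont_def by (intro tendsto_intros r)
  then have lim: "((\<lambda>y. (B + r y) * norm (g y - g x) * K) \<longlongrightarrow> 0) (at x)" by simp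
  have "((\<lambda>y. norm (pr (f y) (g y - g x)) / norm (y - x)) \<longlongrightarrow> 0) (at x)"
  proof (rule Lim_null_comparison[OF _ lim], rule eventually_at_topological[THEN iffD2], intro exI conjI ballI impI)
    show "open UNIV" "x \<in> UNIV" by simp_all
    fix y assume "y \<noteq> x"
    then have yx: "norm (y - x) > 0" by simp
    have "norm (f y) \<le> norm (f' (y - x)) + norm (f y - f x - f' (y - x))"
      using norm_triangle_ineq[of "f' (y - x)" "f y - f x - f' (y - x)"] by (simp add: f(2))
    also have "\<dots> \<le> norm (y - x) * B + norm (y - x) * r y"
      using B yx by (simp add: r_def)
    finally have "norm (f y) \<le> norm (y - x) * (B + r y)" by (simp add: algebra_simps)
    then have "norm (f y) * norm (g y - g x) * K \<le> norm (y - x) * (B + r y) * norm (g y - g x) * K"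
      using K(1) by (intro mult_right_mono) simp_all
    then have "norm (pr (f y) (g y - g x)) \<le> norm (y - x) * (B + r y) * norm (g y - g x) * K"
      using K(2)[of "f y" "g y - g x"] by linarith
    then show "norm (norm (pr (f y) (g y - g x)) / norm (y - x)) \<le> (B + r y) * norm (g y - g x) * K"
      using yx by (simp add: divide_le_eq ac_simps)
  qed
  then have "((\<lambda>y. pr (f y) (g y - g x)) has_derivative (\<lambda>h. 0)) (at x)"
    unfolding has_derivative_iff_norm by (simp add: f(2) zero_left)
  from has_derivative_add[OF FDERIV[OF f(1) has_derivative_const[of "g x"]] this]
  show ?thesis by (simp add: diff_right zero_right)
qed

lemmas linear_blinfun_apply = bounded_linear.linear[OF blinfun.bounded_linear_right]

lemma linear_inj_inv:
  fixes L :: "'e::euclidean_space \<Rightarrow> 'e"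
  assumes "linear L" "inj L"
  shows "L (inv L z) = z" "inv L (L z) = z" "bounded_linear (inv L)"
proof -
  show *: "L (inv L z) = z" for z
    using eucl.linear_inj_imp_surj[OF assms] by (rule surj_f_inv_f)
  show "inv L (L z) = z" by (rule inv_f_f[OF assms(2)])
  have "linear (inv L)"
    by (rule linearI; rule injD[OF assms(2)]) (simp_all add: * linear_add[OF assms(1)] linear_cmul[OF assms(1)])
  then show "bounded_linear (inv L)" by (rule linear_conv_bounded_linear[THEN iffD1])
qed

text \<open>Injectivity bounds \<open>L x z\<close> below by m |z|. For z = F y - F x this leaves an
  error |L y - L x| |F y|, in which \<open>F y\<close> is not yet known to be bounded; once |L y - L
  x| < m/2, its part |F y - F x| is absorbed by the left side.\<close>

lemma continuous_on_inv_blinfun_apply: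
  fixes L :: "'x::euclidean_space \<Rightarrow> 'e::euclidean_space \<Rightarrow>\<^sub>L 'e"
  assumes "open S" "continuous_on S L" "continuous_on S R"
    and inj: "\<And>x. x \<in> S \<Longrightarrow> inj (blinfun_apply (L x))"
  shows "continuous_on S (\<lambda>x. inv (blinfun_apply (L x)) (R x))"
proof (rule continuous_at_imp_continuous_on, rule ballI)
  fix x assume x: "x \<in> S"
  define F where "F y = inv (blinfun_apply (L y)) (R y)" for y
  have LF: "L y (F y) = R y" if "y \<in> S" for y
    unfolding F_def by (rule linear_inj_inv(1)[OF linear_blinfun_apply inj[OF that]])
  have lim: "(L \<longlongrightarrow> L x) (at x)" "(R \<longlongrightarrow> R x) (at x)"
    using assms(2,3) x continuous_on_eq_continuous_at[OF assms(1)] by (auto simp: isCont_def)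
  obtain m where m: "m > 0" "\<And>z. m * norm z \<le> norm (L x z)"
    using linear_inj_bounded_below_pos[OF linear_blinfun_apply inj[OF x]] by (metis mult.commute)
  have ev: "\<forall>\<^sub>F y in at x. y \<in> S \<and> norm (L y - L x) < m / 2"
    using tendstoD[OF lim(1), of "m/2"] m(1) eventually_at_in_open'[OF assms(1) x]
    by (auto simp: dist_norm intro: eventually_conj)
  have "((\<lambda>y. 2 / m * (norm (R y - R x) + norm (L y - L x) * norm (F x))) \<longlongrightarrow>
      2 / m * (norm (R x - R x) + norm (L x - L x) * norm (F x))) (at x)"
    by (intro tendsto_intros lim)
  then have "((\<lambda>y. 2 / m * (norm (R y - R x) + norm (L y - L x) * norm (F x))) \<longlongrightarrow> 0) (at x)"
    by simp
  moreover have "\<forall>\<^sub>F y in at x. norm (F y - F x) \<le> 2 / m * (norm (R y - R x) + norm (L y - L x) * norm (F x))"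
    using ev
  proof (rule eventually_mono)
    fix y assume y: "y \<in> S \<and> norm (L y - L x) < m / 2"
    have "L x (F y - F x) = (R y - R x) - (L y - L x) (F y)"
      using LF[of y] LF[OF x] y by (simp add: blinfun.bilinear_simps)
    then have "m * norm (F y - F x) \<le> norm ((R y - R x) - (L y - L x) (F y))"
      using m(2) by metis
    also have "\<dots> \<le> norm (R y - R x) + norm (L y - L x) * norm (F y)"
      using norm_triangle_ineq4 norm_blinfun[of "L y - L x" "F y"] by (smt (verit))
    also have "\<dots> \<le> norm (R y - R x) + norm (L y - L x) * (norm (F y - F x) + norm (F x))"
      using norm_triangle_ineq[of "F y - F x" "F x"] by (intro add_left_mono mult_left_mono) simp_all
    also have "\<dots> \<le> norm (R y - R x) + norm (L y - L x) * norm (F x) + m / 2 * norm (F y - F x)"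
      using mult_right_mono[of "norm (L y - L x)" "m/2" "norm (F y - F x)"] y
      by (simp add: algebra_simps)
    finally show "norm (F y - F x) \<le> 2 / m * (norm (R y - R x) + norm (L y - L x) * norm (F x))"
      using m(1) by (simp add: field_simps)
  qed
  ultimately have "((\<lambda>y. F y - F x) \<longlongrightarrow> 0) (at x)"
    by (rule Lim_null_comparison[rotated])
  then show "isCont (\<lambda>x. inv (blinfun_apply (L x)) (R x)) x"
    unfolding isCont_def F_def by (rule LIM_zero_cancel)
qed

text \<open>The derivative of the solution F in a fixed direction solves the system with the same
  \<open>L\<close> and the right side R' - L' F. That right side has order \<open>n\<close> because
  F itself does by the induction hypothesis, so the induction must generalise over
  \<open>R\<close>.\<close>

lemma Ck_on_inv_blinfun_apply:
  fixes L :: "'x::euclidean_space \<Rightarrow> 'e::euclidean_space \<Rightarrow>\<^sub>L 'e"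
  assumes S: "open S" and L: "smooth_on S L"
    and inj: "\<And>x. x \<in> S \<Longrightarrow> inj (blinfun_apply (L x))"
    and "Ck_on n S R"
  shows "Ck_on n S (\<lambda>x. inv (blinfun_apply (L x)) (R x))"
  using assms(4)
proof (induction n arbitrary: R)
  case 0
  then show ?case
    using continuous_on_inv_blinfun_apply[OF S smooth_on_continuous_on[OF L] _ inj] by simp
next
  case (Suc n)
  define I where "I x = inv (blinfun_apply (L x))" for x
  define F where "F x = I x (R x)" for x
  define L' where "L' x = frechet_derivative L (at x)" for x
  define R' where "R' x = frechet_derivative R (at x)" for x
  note I = linear_inj_inv[OF linear_blinfun_apply inj, folded I_def]
  have LF: "L y (F y) = R y" if "y \<in> S" for y
    unfolding F_def by (rule I(1)[OF that])
  have F: "Ck_on n S F"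
    unfolding F_def I_def by (rule Suc.IH[OF Ck_on_Suc_imp[OF Suc.prems]])
  have "(F has_derivative (\<lambda>h. I x (R' x h - L' x h (F x)))) (at x)" if x: "x \<in> S" for x
  proof -
    have "isCont F x"
      using Ck_on_imp_continuous[OF F] x continuous_on_eq_continuous_at[OF S] by blast
    moreover have "((\<lambda>y. L y - L x) has_derivative L' x) (at x)"
      using has_derivative_diff[OF smooth_on_has_derivative[OF L x] has_derivative_const] by (simp add: L'_def)
    ultimately have 1: "((\<lambda>y. (L y - L x) (F y)) has_derivative (\<lambda>h. L' x h (F x))) (at x)"
      by (intro has_derivative_bilinear_zero_factor[OF bounded_bilinear_blinfun_apply]) simp_all
    \<comment> \<open>Since \<open>L x (F y) = R y - (L y - L x) (F y)\<close>, the inverse at the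
      fixed point \<open>x\<close> suffices to express \<open>F y\<close>; no varying inverse has to
      be differentiated.\<close>
    have "((\<lambda>y. I x (R y - (L y - L x) (F y))) has_derivative (\<lambda>h. I x (R' x h - L' x h (F x)))) (at x)"
      using Ck_on_has_derivative[OF Suc.prems x]
      by (intro bounded_linear.has_derivative[OF I(3)[OF x]] has_derivative_diff 1) (simp add: R'_def)
    then show ?thesis
    proof (rule has_derivative_transform_within_open[OF _ S x])
      fix y assume "y \<in> S"
      then have "R y - (L y - L x) (F y) = L x (F y)" by (simp add: blinfun.bilinear_simps LF)
      then show "I x (R y - (L y - L x) (F y)) = F y" by (simp add: I(2)[OF x])
    qed
  qed
  then have "Ck_on (Suc n) S F"
  proof (rule Ck_on_SucI'[OF S])
    fix v
    have "Ck_on n S (\<lambda>x. R' x v)" using Suc.prems by (simp add: R'_def)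
    moreover have "Ck_on n S (\<lambda>x. - (L' x v (F x)))"
      using smooth_on_frechet_derivative[OF L, THEN smooth_onD_Ck_on] unfolding L'_def
      by (intro Ck_on_compose_linear[OF bounded_linear_minus[OF bounded_linear_ident]]
          Ck_on_bilinear[OF bounded_bilinear_blinfun_apply] S F)
    ultimately have "Ck_on n S (\<lambda>x. R' x v - L' x v (F x))"
      using Ck_on_add[OF S] by fastforce
    then show "Ck_on n S (\<lambda>x. I x (R' x v - L' x v (F x)))"
      unfolding I_def by (rule Suc.IH)
  qed
  then show ?case unfolding F_def I_def .
qed

lemma smooth_on_solve_blinfun:
  fixes L :: "'x::euclidean_space \<Rightarrow> 'e::euclidean_space \<Rightarrow>\<^sub>L 'e"
  assumes S: "open S" and L: "smooth_on S L" and R: "smooth_on S R"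
    and inj: "\<And>x. x \<in> S \<Longrightarrow> inj (blinfun_apply (L x))"
    and LF: "\<And>x. x \<in> S \<Longrightarrow> L x (F x) = R x"
  shows "smooth_on S F"
proof (rule smooth_on_cong[OF S])
  show "smooth_on S (\<lambda>x. inv (blinfun_apply (L x)) (R x))"
    using Ck_on_inv_blinfun_apply[OF S L inj] R by (simp add: smooth_on_def)
  show "inv (blinfun_apply (L x)) (R x) = F x" if "x \<in> S" for x
    using LF[OF that] inv_f_f[OF inj[OF that]] by metis
qed

text \<open>Represents the forms by endomorphisms, so that prescribing \<open>B x (F x)\<close> on a
  basis becomes a single vector equation with an injective operator.\<close>

lemma smooth_on_solve_bilinear:
  fixes B :: "'x::euclidean_space \<Rightarrow> 'e::euclidean_space \<Rightarrow> 'e \<Rightarrow> real"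
  assumes S: "open S" and B: "\<And>i j. i \<in> Basis \<Longrightarrow> j \<in> Basis \<Longrightarrow> smooth_on S (\<lambda>x. B x i j)"
    and R: "\<And>j. j \<in> Basis \<Longrightarrow> smooth_on S (R j)"
    and bil: "\<And>x. x \<in> S \<Longrightarrow> bilinear (B x)"
    and nondeg: "\<And>x u. x \<in> S \<Longrightarrow> (\<And>v. B x u v = 0) \<Longrightarrow> u = 0"
    and F: "\<And>x j. x \<in> S \<Longrightarrow> j \<in> Basis \<Longrightarrow> B x (F x) j = R j x"
  shows "smooth_on S F"
proof -
  \<comment> \<open>The matrix unit that sends \<open>u\<close> to
    \<open>(u \<bullet> i) *\<^sub>R j\<close>; weighting these by \<open>B x i j\<close> gives the
    operator with \<open>L x u \<bullet> k = B x u k\<close>.\<close>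
  define E where "E i j = (blinfun_scaleR_left j o\<^sub>L blinfun_inner_left i :: 'e \<Rightarrow>\<^sub>L 'e)" for i j
  define L where "L x = (\<Sum>i\<in>Basis. \<Sum>j\<in>Basis. B x i j *\<^sub>R E i j)" for x
  have L_inner: "L x u \<bullet> k = B x u k" if "x \<in> S" "k \<in> Basis" for x u k
  proof -
    have "L x u \<bullet> k = (\<Sum>i\<in>Basis. \<Sum>j\<in>Basis. B x i j * ((u \<bullet> i) * (j \<bullet> k)))"
      by (simp add: L_def E_def blinfun.sum_left blinfun.scaleR_left inner_sum_left ac_simps)
    also have "\<dots> = (\<Sum>i\<in>Basis. (u \<bullet> i) * B x i k)"
      using that(2) by (simp add: inner_Basis if_distrib cong: if_cong) (simp add: mult.commute)
    also have "\<dots> = B x u k"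
      using linear_basis_expansion[of "\<lambda>u. B x u k" u] bil[OF that(1)] by (simp add: bilinear_def)
    finally show ?thesis .
  qed
  have "smooth_on S L"
    unfolding L_def by (intro smooth_on_sum smooth_on_scaleR S B smooth_on_const)
  moreover have "smooth_on S (\<lambda>x. \<Sum>j\<in>Basis. R j x *\<^sub>R j)"
    by (intro smooth_on_sum smooth_on_scaleR S R smooth_on_const)
  moreover have "inj (blinfun_apply (L x))" if x: "x \<in> S" for x
    unfolding linear_injective_0[OF linear_blinfun_apply]
  proof (intro allI impI)
    fix u assume 0: "L x u = 0"
    have "B x u k = 0" if "k \<in> Basis" for k
      using L_inner[OF x that, of u] 0 by simp
    then have "B x u v = 0" for v
      using linear_basis_expansion[of "B x u" v] bil[OF x] by (simp add: bilinear_def)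
    then show "u = 0" by (rule nondeg[OF x])
  qed
  moreover have "L x (F x) = (\<Sum>j\<in>Basis. R j x *\<^sub>R j)" if "x \<in> S" for x
    by (rule euclidean_eqI) (simp add: L_inner that F inner_sum_left inner_Basis if_distrib cong: if_cong)
  ultimately show ?thesis by (rule smooth_on_solve_blinfun[OF S])
qed

section \<open>Bilinear forms that depend on a parameter\<close>

lemma bilinear_basis_expansion:
  fixes B :: "'e::euclidean_space \<Rightarrow> 'e \<Rightarrow> real"
  assumes "bilinear B"
  shows "B u v = (\<Sum>i\<in>Basis. \<Sum>j\<in>Basis. (u \<bullet> i) * (v \<bullet> j) * B i j)"
proof -
  have "linear (\<lambda>u. B u v)" and l: "linear (B i)" for i using assms by (auto simp: bilinear_def)
  from linear_basis_expansion[OF this(1), of u]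
  have "B u v = (\<Sum>i\<in>Basis. (u \<bullet> i) * B i v)" by simp
  also have "\<dots> = (\<Sum>i\<in>Basis. (u \<bullet> i) * (\<Sum>j\<in>Basis. (v \<bullet> j) * B i j))"
    using linear_basis_expansion[OF l, of _ v] by simp
  finally show ?thesis by (simp add: sum_distrib_left mult.assoc)
qed

lemma bilinear_coefficients:
  fixes c :: "'e::euclidean_space \<Rightarrow> 'e \<Rightarrow> real"
  shows "bilinear (\<lambda>u v. \<Sum>i\<in>Basis. \<Sum>j\<in>Basis. (u \<bullet> i) * (v \<bullet> j) * c i j)"
  unfolding bilinear_def
  by (intro conjI allI linearI)
    (simp_all add: inner_add_left ring_distribs sum.distrib sum_distrib_left ac_simps)

lemma frechet_derivative_bilinear_family:
  fixes \<Gamma> :: "'x::real_normed_vector \<Rightarrow> 'e::euclidean_space \<Rightarrow> 'e \<Rightarrow> real"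
  assumes bil: "\<And>x. bilinear (\<Gamma> x)"
    and \<Gamma>: "\<And>u v. (\<lambda>x. \<Gamma> x u v) differentiable at x"
  shows "frechet_derivative (\<lambda>x. \<Gamma> x u v) (at x) h
    = (\<Sum>i\<in>Basis. \<Sum>j\<in>Basis. (u \<bullet> i) * (v \<bullet> j) * frechet_derivative (\<lambda>x. \<Gamma> x i j) (at x) h)"
proof -
  note D = \<Gamma>[unfolded frechet_derivative_works]
  have "((\<lambda>x. \<Sum>i\<in>Basis. \<Sum>j\<in>Basis. (u \<bullet> i) * (v \<bullet> j) * \<Gamma> x i j) has_derivative
      (\<lambda>h. \<Sum>i\<in>Basis. \<Sum>j\<in>Basis. (u \<bullet> i) * (v \<bullet> j) * frechet_derivative (\<lambda>x. \<Gamma> x i j) (at x) h)) (at x)"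
    by (intro has_derivative_sum has_derivative_mult_right D)
  from this[unfolded bilinear_basis_expansion[OF bil, symmetric]]
  show ?thesis by (rule fun_cong[OF has_derivative_unique[OF D]])
qed

lemma bilinear_frechet_derivative:
  fixes \<Gamma> :: "'x::real_normed_vector \<Rightarrow> 'e::euclidean_space \<Rightarrow> 'e \<Rightarrow> real"
  assumes bil: "\<And>x. bilinear (\<Gamma> x)"
    and \<Gamma>: "\<And>u v. (\<lambda>x. \<Gamma> x u v) differentiable at x"
  shows "bilinear (\<lambda>u v. frechet_derivative (\<lambda>x. \<Gamma> x u v) (at x) h)"
proof -
  have "(\<lambda>u v. frechet_derivative (\<lambda>x. \<Gamma> x u v) (at x) h) = (\<lambda>u v.
      \<Sum>i\<in>Basis. \<Sum>j\<in>Basis. (u \<bullet> i) * (v \<bullet> j) * frechet_derivative (\<lambda>x. \<Gamma> x i j) (at x) h)"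
    by (intro ext frechet_derivative_bilinear_family[OF assms])
  then show ?thesis by (simp only: bilinear_coefficients)
qed

text \<open>A product rule in three slots. Differentiability is assumed for fixed arguments only, so
  the family is expanded into scalar coefficients, differentiated termwise and reassembled.\<close>

lemma has_derivative_bilinear_family:
  fixes \<Gamma> :: "'e::euclidean_space \<Rightarrow> 'e \<Rightarrow> 'e \<Rightarrow> real"
  assumes bil: "\<And>x. bilinear (\<Gamma> x)"
    and \<Gamma>: "\<And>u v. (\<lambda>x. \<Gamma> x u v) differentiable at (\<psi> z)"
    and \<psi>: "(\<psi> has_derivative \<psi>') (at z)"
    and m: "(m has_derivative m') (at z)" and n: "(n has_derivative n') (at z)"
  shows "((\<lambda>z. \<Gamma> (\<psi> z) (m z) (n z)) has_derivative
    (\<lambda>h. frechet_derivative (\<lambda>x. \<Gamma> x (m z) (n z)) (at (\<psi> z)) (\<psi>' h)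
      + \<Gamma> (\<psi> z) (m' h) (n z) + \<Gamma> (\<psi> z) (m z) (n' h))) (at z)"
proof -
  define D where "D u v = frechet_derivative (\<lambda>x. \<Gamma> x u v) (at (\<psi> z))" for u v
  have D: "((\<lambda>x. \<Gamma> x u v) has_derivative D u v) (at (\<psi> z))" for u v
    using \<Gamma>[of u v] unfolding D_def frechet_derivative_works .
  have D_expand: "D u v h = (\<Sum>i\<in>Basis. \<Sum>j\<in>Basis. (u \<bullet> i) * (v \<bullet> j) * D i j h)" for u v h
    unfolding D_def by (rule frechet_derivative_bilinear_family[OF bil \<Gamma>])
  have comp: "((\<lambda>z. \<Gamma> (\<psi> z) i j) has_derivative (\<lambda>h. D i j (\<psi>' h))) (at z)" for i j
    using diff_chain_at[OF \<psi> D[of i j]] by (simp add: o_def)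
  have *: "((\<lambda>z. (m z \<bullet> i) * (n z \<bullet> j) * \<Gamma> (\<psi> z) i j) has_derivative
      (\<lambda>h. (m z \<bullet> i) * (n z \<bullet> j) * D i j (\<psi>' h) + (m' h \<bullet> i) * (n z \<bullet> j) * \<Gamma> (\<psi> z) i j
        + (m z \<bullet> i) * (n' h \<bullet> j) * \<Gamma> (\<psi> z) i j)) (at z)" for i j
    by (rule has_derivative_eq_rhs[OF has_derivative_mult[OF has_derivative_mult[OF
          has_derivative_inner_left[OF m, of i] has_derivative_inner_left[OF n, of j]] comp[of i j]]])
      (auto simp: algebra_simps)
  have "((\<lambda>z. \<Sum>i\<in>Basis. \<Sum>j\<in>Basis. (m z \<bullet> i) * (n z \<bullet> j) * \<Gamma> (\<psi> z) i j) has_derivative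
      (\<lambda>h. \<Sum>i\<in>Basis. \<Sum>j\<in>Basis. (m z \<bullet> i) * (n z \<bullet> j) * D i j (\<psi>' h) + (m' h \<bullet> i) * (n z \<bullet> j) * \<Gamma> (\<psi> z) i j
        + (m z \<bullet> i) * (n' h \<bullet> j) * \<Gamma> (\<psi> z) i j)) (at z)"
    by (intro has_derivative_sum *)
  then show ?thesis
    unfolding sum.distrib bilinear_basis_expansion[OF bil, symmetric] D_expand[symmetric]
    unfolding D_def .
qed

text \<open>Expansion in \<open>Basis\<close> separates the coefficients, which depend smoothly on
  the point, from the moving arguments. Bilinearity is asked on \<open>U\<close> alone so that
  derivatives of the metric, controlled inside a chart, can be inserted.\<close>

lemma smooth_on_bilinear_family:
  fixes \<Gamma> :: "'y::euclidean_space \<Rightarrow> 'e::euclidean_space \<Rightarrow> 'e \<Rightarrow> real"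
    and \<psi> :: "'x::euclidean_space \<Rightarrow> 'y"
  assumes bil: "\<And>x. x \<in> U \<Longrightarrow> bilinear (\<Gamma> x)" and \<Gamma>: "\<And>u v. smooth_on U (\<lambda>x. \<Gamma> x u v)"
    and S: "open S" and \<psi>: "smooth_on S \<psi>" "\<psi> ` S \<subseteq> U" and m: "smooth_on S m" and n: "smooth_on S n"
  shows "smooth_on S (\<lambda>z. \<Gamma> (\<psi> z) (m z) (n z))"
proof (rule smooth_on_cong[OF S])
  show "smooth_on S (\<lambda>z. \<Sum>i\<in>Basis. \<Sum>j\<in>Basis. (m z \<bullet> i) * (n z \<bullet> j) * \<Gamma> (\<psi> z) i j)"
    by (intro smooth_on_sum smooth_on_mult smooth_on_inner S m n smooth_on_const
        smooth_on_compose[OF S \<psi>(1) \<Gamma> \<psi>(2)])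
  show "(\<Sum>i\<in>Basis. \<Sum>j\<in>Basis. (m z \<bullet> i) * (n z \<bullet> j) * \<Gamma> (\<psi> z) i j) = \<Gamma> (\<psi> z) (m z) (n z)" if "z \<in> S" for z
    using that \<psi>(2) by (intro bilinear_basis_expansion[symmetric] bil) auto
qed

text \<open>Nondegeneracy makes the endomorphism representing \<open>B\<close> injective, hence
  surjective in finite dimension.\<close>

lemma nondegenerate_ex1:
  fixes B :: "'e::euclidean_space \<Rightarrow> 'e \<Rightarrow> real"
  assumes B: "bilinear B" and nondeg: "\<And>u. (\<And>v. B u v = 0) \<Longrightarrow> u = 0" and r: "linear r"
  shows "\<exists>!u. \<forall>v. B u v = r v"
proof -
  have lin: "linear (B u)" "linear (\<lambda>u. B u v)" for u v using B by (auto simp: bilinear_def)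
  define L where "L u = (\<Sum>j\<in>Basis. B u j *\<^sub>R j)" for u
  have L: "linear L"
    by (rule linearI) (simp_all add: L_def linear_add[OF lin(2)] linear_cmul[OF lin(2)]
        scaleR_add_left sum.distrib scaleR_sum_right)
  have Lj: "L u \<bullet> j = B u j" if "j \<in> Basis" for u j
    using that by (simp add: L_def inner_sum_left inner_Basis if_distrib cong: if_cong)
  have ext: "B u = s" if "linear s" "\<And>j. j \<in> Basis \<Longrightarrow> B u j = s j" for u s
    using linear_eq_stdbasis[OF lin(1) that] .
  have "u = 0" if "L u = 0" for u
  proof (rule nondeg)
    have "B u = (\<lambda>v. 0)" by (rule ext[OF linear_zero]) (simp add: Lj[symmetric] that)
    then show "B u v = 0" for v by simp
  qed
  then have "inj L" using linear_injective_0[OF L] by blast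
  then have "surj L" by (rule eucl.linear_inj_imp_surj[OF L])
  then obtain u where u: "L u = (\<Sum>j\<in>Basis. r j *\<^sub>R j)" by (metis surjD)
  have "B u = r"
  proof (rule ext[OF r])
    fix j :: 'e assume "j \<in> Basis"
    then show "B u j = r j"
      using Lj[of j u] by (simp add: u inner_sum_left inner_Basis if_distrib cong: if_cong)
  qed
  moreover have "u' = u" if "\<forall>v. B u' v = r v" for u'
  proof -
    have "B (u' - u) v = 0" for v
      using that \<open>B u = r\<close> by (simp add: linear_diff[OF lin(2)])
    from nondeg[OF this] show ?thesis by simp
  qed
  ultimately show ?thesis by blast
qed

section \<open>Bump functions\<close>

text \<open>For \<open>k = 0\<close> this is the classical smooth function that is not analytic at
  0. The powers in the denominator make the span of the family closed under differentiation.\<close>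

definition flat :: "nat \<Rightarrow> real \<Rightarrow> real" where
  "flat k t = (if t > 0 then exp (- (1 / t)) / t ^ k else 0)"

lemma flat_tendsto_0: "(flat k \<longlongrightarrow> 0) (at 0)"
  unfolding filterlim_at_split
proof
  show "(flat k \<longlongrightarrow> 0) (at_left 0)"
    by (rule tendsto_eventually) (auto simp: flat_def eventually_at_filter)
  \<comment> \<open>With s = 1/t this is the limit of s^k / exp s as s tends to infinity.\<close>
  have "((\<lambda>t. inverse t ^ k / exp (inverse t)) \<longlongrightarrow> 0) (at_right (0::real))"
    by (rule filterlim_compose[OF tendsto_power_div_exp_0 filterlim_inverse_at_top_right])
  then show "(flat k \<longlongrightarrow> 0) (at_right 0)"
  proof (rule Lim_transform_eventually)
    show "\<forall>\<^sub>F t in at_right 0. inverse t ^ k / exp (inverse t) = flat k t"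
      by (auto simp: flat_def eventually_at_filter exp_minus field_simps power_inverse)
  qed
qed

lemma flat_has_real_derivative:
  "(flat k has_real_derivative (flat (k + 2) t - real k * flat (k + 1) t)) (at t)"
proof -
  consider "t > 0" | "t < 0" | "t = 0" by linarith
  then show ?thesis
  proof cases
    case 1
    have "((\<lambda>t. exp (- (1 / t)) / t ^ k) has_real_derivative flat (k + 2) t - real k * flat (k + 1) t) (at t)"
      using 1 by (auto intro!: derivative_eq_intros simp: flat_def field_simps power2_eq_square)
        (cases k; simp add: field_simps)
    then show ?thesis
      by (rule has_field_derivative_transform_within_open[of _ _ _ "{0<..}"]) (use 1 in \<open>auto simp: flat_def\<close>)
  next
    case 2
    have "((\<lambda>t. 0) has_real_derivative flat (k + 2) t - real k * flat (k + 1) t) (at t)"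
      using 2 by (simp add: flat_def)
    then show ?thesis
      by (rule has_field_derivative_transform_within_open[of _ _ _ "{..<0}"]) (use 2 in \<open>auto simp: flat_def\<close>)
  next
    case 3
    \<comment> \<open>The difference quotient of \<open>flat k\<close> at 0 is
      \<open>flat (k + 1)\<close>, on both sides of 0.\<close>
    have "(flat (k + 1) \<longlongrightarrow> 0) (at 0)" by (rule flat_tendsto_0)
    then have "((\<lambda>y. (flat k y - flat k 0) / (y - 0)) \<longlongrightarrow> 0) (at 0)"
      by (rule Lim_transform_eventually) (auto simp: flat_def eventually_at_filter)
    then show ?thesis unfolding has_field_derivative_iff 3 by (simp add: flat_def)
  qed
qed

lemma smooth_on_flat: "smooth_on S (flat k)"
proof -
  have "Ck_on n UNIV (flat k)" for n k
  proof (induction n arbitrary: k)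
    case 0
    show ?case
      using DERIV_isCont[OF flat_has_real_derivative] by (simp add: continuous_at_imp_continuous_on)
  next
    case (Suc n)
    have "(flat k has_derivative (\<lambda>v. (flat (k + 2) t + (- real k) * flat (k + 1) t) * v)) (at t)" for t
      using flat_has_real_derivative[of k t] unfolding has_field_derivative_def by simp
    then show ?case
    proof (rule Ck_on_SucI'[OF open_UNIV])
      show "Ck_on n UNIV (\<lambda>t. (flat (k + 2) t + (- real k) * flat (k + 1) t) * v)" for v
        by (rule Ck_on_mult[OF open_UNIV Ck_on_add[OF open_UNIV Suc.IH Ck_on_mult[OF open_UNIV Ck_on_const Suc.IH]] Ck_on_const])
    qed
  qed
  then show ?thesis
    unfolding smooth_on_def using Ck_on_subset[OF _ subset_UNIV] by blast
qed

lemma smooth_bump_exists: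
  fixes a :: "'e::euclidean_space"
  assumes "r > 0"
  obtains \<rho> :: "'e \<Rightarrow> real" where "smooth_on UNIV \<rho>" "\<rho> a \<noteq> 0" "\<And>x. x \<notin> cball a r \<Longrightarrow> \<rho> x = 0"
proof
  \<comment> \<open>The square of the distance is used because the distance is not smooth at
    \<open>a\<close>.\<close>
  let ?\<rho> = "\<lambda>x. flat 0 (r\<^sup>2 - (x - a) \<bullet> (x - a))"
  show "smooth_on UNIV ?\<rho>"
    by (intro smooth_on_compose[OF _ _ smooth_on_flat[of UNIV]] smooth_on_intros smooth_on_const open_UNIV subset_UNIV)
  show "?\<rho> a \<noteq> 0" using assms by (simp add: flat_def)
  show "?\<rho> x = 0" if "x \<notin> cball a r" for x
  proof -
    have "r < norm (x - a)" using that by (simp add: dist_norm norm_minus_commute)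
    then have "r\<^sup>2 \<le> (x - a) \<bullet> (x - a)"
      using assms by (simp add: dot_square_norm)
    then show ?thesis by (simp add: flat_def)
  qed
qed

section \<open>Derivatives applied to varying vectors\<close>

lemma smooth_on_derivative_apply:
  fixes \<phi> :: "'e::euclidean_space \<Rightarrow> 'f::real_normed_vector" and \<psi> :: "'x::euclidean_space \<Rightarrow> 'e"
  assumes \<phi>: "smooth_on V \<phi>" and S: "open S" and \<psi>: "smooth_on S \<psi>" "\<psi> ` S \<subseteq> V" and m: "smooth_on S m"
  shows "smooth_on S (\<lambda>z. frechet_derivative \<phi> (at (\<psi> z)) (m z))"
proof (rule smooth_on_cong[OF S])
  show "smooth_on S (\<lambda>z. \<Sum>b\<in>Basis. (m z \<bullet> b) *\<^sub>R frechet_derivative \<phi> (at (\<psi> z)) b)"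
    by (intro smooth_on_sum smooth_on_scaleR smooth_on_inner S m smooth_on_const
        smooth_on_compose[OF S \<psi>(1) smooth_on_frechet_derivative[OF \<phi>] \<psi>(2)])
  show "(\<Sum>b\<in>Basis. (m z \<bullet> b) *\<^sub>R frechet_derivative \<phi> (at (\<psi> z)) b) = frechet_derivative \<phi> (at (\<psi> z)) (m z)"
    if "z \<in> S" for z
    using \<psi>(2) that by (intro linear_basis_expansion[symmetric] smooth_on_linear_derivative[OF \<phi>]) auto
qed

text \<open>The origin of the second derivatives that appear when the fibre part of a coordinate
  change on TM is differentiated.\<close>

lemma has_derivative_derivative_apply:
  fixes \<phi> :: "'e::euclidean_space \<Rightarrow> 'f::real_normed_vector" and \<psi> :: "'x::euclidean_space \<Rightarrow> 'e"
  assumes \<phi>: "smooth_on V \<phi>" and V: "open V" and z: "\<psi> z \<in> V"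
    and \<psi>: "(\<psi> has_derivative \<psi>') (at z)" and m: "(m has_derivative m') (at z)"
  shows "((\<lambda>z. frechet_derivative \<phi> (at (\<psi> z)) (m z)) has_derivative
    (\<lambda>h. frechet_derivative (\<lambda>x. frechet_derivative \<phi> (at x) (m z)) (at (\<psi> z)) (\<psi>' h)
      + frechet_derivative \<phi> (at (\<psi> z)) (m' h))) (at z)"
proof -
  let ?D = "\<lambda>x. frechet_derivative \<phi> (at x)"
  let ?D2 = "\<lambda>y. frechet_derivative (\<lambda>x. ?D x y) (at (\<psi> z))"
  have lin: "(\<Sum>b\<in>Basis. (y \<bullet> b) *\<^sub>R ?D x b) = ?D x y" if "x \<in> V" for x y
    by (rule linear_basis_expansion[OF smooth_on_linear_derivative[OF \<phi> that], symmetric])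
  have D2: "((\<lambda>x. ?D x y) has_derivative ?D2 y) (at (\<psi> z))" for y
    by (rule smooth_on_has_derivative[OF smooth_on_frechet_derivative[OF \<phi>] z])
  \<comment> \<open>Here \<open>m z\<close> is frozen: this shows that \<open>?D2\<close> is linear
    in that argument, which allows the expanded sum to be recombined below.\<close>
  have "((\<lambda>x. \<Sum>b\<in>Basis. (m z \<bullet> b) *\<^sub>R ?D x b) has_derivative (\<lambda>h. \<Sum>b\<in>Basis. (m z \<bullet> b) *\<^sub>R ?D2 b h)) (at (\<psi> z))"
    by (intro has_derivative_sum has_derivative_scaleR_right D2)
  then have "((\<lambda>x. ?D x (m z)) has_derivative (\<lambda>h. \<Sum>b\<in>Basis. (m z \<bullet> b) *\<^sub>R ?D2 b h)) (at (\<psi> z))"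
    by (rule has_derivative_transform_within_open[OF _ V z]) (rule lin)
  then have D2_sum: "?D2 (m z) h = (\<Sum>b\<in>Basis. (m z \<bullet> b) *\<^sub>R ?D2 b h)" for h
    by (rule fun_cong[OF has_derivative_unique[OF D2]])
  have comp: "((\<lambda>z. ?D (\<psi> z) b) has_derivative (\<lambda>h. ?D2 b (\<psi>' h))) (at z)" for b
    using diff_chain_at[OF \<psi> D2[of b]] by (simp add: o_def)
  have "((\<lambda>z. \<Sum>b\<in>Basis. (m z \<bullet> b) *\<^sub>R ?D (\<psi> z) b) has_derivative
      (\<lambda>h. \<Sum>b\<in>Basis. (m z \<bullet> b) *\<^sub>R ?D2 b (\<psi>' h) + (m' h \<bullet> b) *\<^sub>R ?D (\<psi> z) b)) (at z)"
    by (intro has_derivative_sum has_derivative_scaleR has_derivative_inner_left m comp)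
  then have "((\<lambda>z. \<Sum>b\<in>Basis. (m z \<bullet> b) *\<^sub>R ?D (\<psi> z) b) has_derivative
      (\<lambda>h. ?D2 (m z) (\<psi>' h) + ?D (\<psi> z) (m' h))) (at z)"
    unfolding sum.distrib D2_sum[symmetric] lin[OF z] .
  moreover have "\<forall>\<^sub>F y in at z. (\<Sum>b\<in>Basis. (m y \<bullet> b) *\<^sub>R ?D (\<psi> y) b) = ?D (\<psi> y) (m y)"
  proof -
    have "(\<psi> \<longlongrightarrow> \<psi> z) (at z)" using has_derivative_continuous[OF \<psi>] by (simp add: continuous_at)
    from topological_tendstoD[OF this V z] show ?thesis
      by (rule eventually_mono) (rule lin)
  qed
  ultimately show ?thesis
    by (rule has_derivative_transform_eventually) (simp_all add: lin[OF z])
qed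

section \<open>Atlases and tangent vectors\<close>

abbreviation transition :: "('a, 'e) chart \<Rightarrow> ('a, 'e) chart \<Rightarrow> 'e \<Rightarrow> 'e" where
  "transition c d \<equiv> snd d \<circ> chart_inv c"

lemma chart_inv_mem: "x \<in> snd c ` fst c \<Longrightarrow> chart_inv c x \<in> fst c"
  by (rule inv_into_into)

lemma chart_chart_inv: "x \<in> snd c ` fst c \<Longrightarrow> snd c (chart_inv c x) = x"
  by (rule f_inv_into_f)

lemma charts_atD: "c \<in> charts_at A p \<Longrightarrow> c \<in> A" "c \<in> charts_at A p \<Longrightarrow> p \<in> fst c"
  by (auto simp: charts_at_def)

lemma charts_atI: "c \<in> A \<Longrightarrow> p \<in> fst c \<Longrightarrow> c \<in> charts_at A p"
  by (auto simp: charts_at_def)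

lemma chart_of_mem: "p \<in> carrier A \<Longrightarrow> chart_of A p \<in> charts_at A p"
  unfolding chart_of_def by (rule someI_ex) (auto simp: carrier_def charts_at_def)

lemma chart_inv_charts_at: "c \<in> A \<Longrightarrow> x \<in> snd c ` fst c \<Longrightarrow> c \<in> charts_at A (chart_inv c x)"
  by (intro charts_atI chart_inv_mem)

lemma charts_at_carrier: "c \<in> charts_at A p \<Longrightarrow> p \<in> carrier A"
  by (auto simp: carrier_def charts_at_def)

locale atlas =
  fixes A :: "('a, 'e::euclidean_space) chart set"
  assumes A: "smooth_atlas A"
begin

lemma chart_inv_chart: "c \<in> A \<Longrightarrow> p \<in> fst c \<Longrightarrow> chart_inv c (snd c p) = p"
  using A by (auto simp: smooth_atlas_def)

lemma open_chart_image: "c \<in> A \<Longrightarrow> open (snd c ` fst c)"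
  using A by (auto simp: smooth_atlas_def)

lemma open_overlap_image: "c \<in> A \<Longrightarrow> d \<in> A \<Longrightarrow> open (snd c ` (fst c \<inter> fst d))"
  using A by (auto simp: smooth_atlas_def)

lemma smooth_on_transition: "c \<in> A \<Longrightarrow> d \<in> A \<Longrightarrow> smooth_on (snd c ` (fst c \<inter> fst d)) (transition c d)"
  using A by (auto simp: smooth_atlas_def)

lemma transition_chart: "c \<in> A \<Longrightarrow> p \<in> fst c \<Longrightarrow> transition c d (snd c p) = snd d p"
  by (simp add: chart_inv_chart)

lemma charts_at_overlap: "c \<in> charts_at A p \<Longrightarrow> d \<in> charts_at A p \<Longrightarrow> snd c p \<in> snd c ` (fst c \<inter> fst d)"
  by (auto simp: charts_at_def)

lemma transition_has_derivative:
  assumes "c \<in> charts_at A p" "d \<in> charts_at A p"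
  shows "(transition c d has_derivative frechet_derivative (transition c d) (at (snd c p))) (at (snd c p))"
  by (rule smooth_on_has_derivative[OF smooth_on_transition[OF assms[THEN charts_atD(1)]] charts_at_overlap[OF assms]])

lemma linear_transition_derivative:
  "c \<in> charts_at A p \<Longrightarrow> d \<in> charts_at A p \<Longrightarrow> linear (frechet_derivative (transition c d) (at (snd c p)))"
  by (rule has_derivative_linear[OF transition_has_derivative])

lemma transition_derivative_self:
  assumes "c \<in> charts_at A p"
  shows "frechet_derivative (transition c c) (at (snd c p)) e = e"
proof -
  have "(transition c c has_derivative (\<lambda>e. e)) (at (snd c p))"
    by (rule has_derivative_transform_within_open[OF has_derivative_ident open_chart_image[OF charts_atD(1)[OF assms]]])
      (use charts_atD[OF assms] chart_inv_chart[OF charts_atD(1)[OF assms]] in auto)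
  from fun_cong[OF frechet_derivative_at[OF this]] show ?thesis by simp
qed

text \<open>The chain rule as a cocycle identity; it makes the family generated by one coordinate
  vector consistent in all charts.\<close>

lemma transition_derivative_compose:
  assumes c: "c \<in> charts_at A p" and d: "d \<in> charts_at A p" and k: "k \<in> charts_at A p"
  shows "frechet_derivative (transition d k) (at (snd d p)) (frechet_derivative (transition c d) (at (snd c p)) e)
    = frechet_derivative (transition c k) (at (snd c p)) e"
proof -
  have cd: "transition c d (snd c p) = snd d p"
    by (rule transition_chart[OF charts_atD[OF c]])
  note cA = charts_atD[OF c] and dA = charts_atD[OF d]
  have "(transition d k \<circ> transition c d has_derivative
      frechet_derivative (transition d k) (at (snd d p)) \<circ> frechet_derivative (transition c d) (at (snd c p))) (at (snd c p))"
    using transition_has_derivative[OF d k]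
    by (intro diff_chain_at transition_has_derivative[OF c d]) (simp only: cd)
  then have "(transition c k has_derivative
      frechet_derivative (transition d k) (at (snd d p)) \<circ> frechet_derivative (transition c d) (at (snd c p))) (at (snd c p))"
    by (rule has_derivative_transform_within_open[OF _ open_overlap_image[OF cA(1) dA(1)] charts_at_overlap[OF c d]])
      (use chart_inv_chart[OF cA(1)] chart_inv_chart[OF dA(1)] in auto)
  from fun_cong[OF frechet_derivative_at[OF this]] show ?thesis by simp
qed

lemma coord_vector_apply:
  "d \<in> charts_at A p \<Longrightarrow> coord_vector A c p e d = frechet_derivative (transition c d) (at (snd c p)) e"
  by (simp add: coord_vector_def)

lemma coord_vector_mem: "c \<in> charts_at A p \<Longrightarrow> coord_vector A c p e \<in> tangent_space A p"
  by (simp add: tangent_space_def coord_vector_def transition_derivative_compose)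

lemma coord_vector_self: "c \<in> charts_at A p \<Longrightarrow> coord_vector A c p e c = e"
  by (simp add: coord_vector_apply transition_derivative_self)

lemma tangent_space_transition:
  "v \<in> tangent_space A p \<Longrightarrow> c \<in> charts_at A p \<Longrightarrow> d \<in> charts_at A p \<Longrightarrow>
    v d = frechet_derivative (transition c d) (at (snd c p)) (v c)"
  unfolding tangent_space_def by blast

text \<open>One coordinate vector determines the whole family: the transition derivatives give the
  other charts at \<open>p\<close>, the padding gives the rest.\<close>

lemma coord_vector_coords:
  assumes "c \<in> charts_at A p" "v \<in> tangent_space A p"
  shows "coord_vector A c p (v c) = v"
proof
  fix d
  show "coord_vector A c p (v c) d = v d"
  proof (cases "d \<in> charts_at A p")
    case True
    then show ?thesis using tangent_space_transition[OF assms(2,1) True] by (simp add: coord_vector_apply)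
  next
    case False
    then have "v d = 0" using assms(2) unfolding tangent_space_def by blast
    then show ?thesis using False by (simp add: coord_vector_def)
  qed
qed

lemma tangent_space_eqI:
  "c \<in> charts_at A p \<Longrightarrow> v \<in> tangent_space A p \<Longrightarrow> w \<in> tangent_space A p \<Longrightarrow> v c = w c \<Longrightarrow> v = w"
  using coord_vector_coords by metis

lemma coord_vector_change:
  assumes "c \<in> charts_at A p" "d \<in> charts_at A p"
  shows "coord_vector A c p e = coord_vector A d p (frechet_derivative (transition c d) (at (snd c p)) e)"
  using coord_vector_coords[OF assms(2) coord_vector_mem[OF assms(1)], of e]
  by (simp add: coord_vector_apply[OF assms(2)])

lemma tangent_space_add:
  assumes "v \<in> tangent_space A p" "w \<in> tangent_space A p"
  shows "(\<lambda>c. v c + w c) \<in> tangent_space A p"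
  unfolding tangent_space_def
proof (rule CollectI, intro conjI ballI allI impI)
  fix c d assume "c \<in> charts_at A p" "d \<in> charts_at A p"
  then show "v d + w d = frechet_derivative (transition c d) (at (snd c p)) (v c + w c)"
    using tangent_space_transition[OF assms(1), of c d] tangent_space_transition[OF assms(2), of c d]
      linear_transition_derivative[of c p d] by (simp add: linear_add)
next
  fix c assume "c \<notin> charts_at A p"
  then have "v c = 0" "w c = 0" using assms unfolding tangent_space_def by blast+
  then show "v c + w c = 0" by simp
qed

lemma tangent_space_scale:
  assumes "v \<in> tangent_space A p"
  shows "(\<lambda>c. r *\<^sub>R v c) \<in> tangent_space A p"
  unfolding tangent_space_def
proof (rule CollectI, intro conjI ballI allI impI)
  fix c d assume "c \<in> charts_at A p" "d \<in> charts_at A p"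
  then show "r *\<^sub>R v d = frechet_derivative (transition c d) (at (snd c p)) (r *\<^sub>R v c)"
    using tangent_space_transition[OF assms(1), of c d]
      linear_transition_derivative[of c p d] by (simp add: linear_cmul)
next
  fix c assume "c \<notin> charts_at A p"
  then have "v c = 0" using assms unfolding tangent_space_def by blast
  then show "r *\<^sub>R v c = 0" by simp
qed

lemma zero_mem_tangent_space: "(\<lambda>c. 0) \<in> tangent_space A p"
  by (simp add: tangent_space_def linear_0[OF linear_transition_derivative])

lemma coord_vector_add:
  assumes "c \<in> charts_at A p"
  shows "coord_vector A c p (e + e') = (\<lambda>d. coord_vector A c p e d + coord_vector A c p e' d)"
  using assms linear_transition_derivative[OF assms] by (auto simp: coord_vector_def linear_add)

lemma coord_vector_scale:
  assumes "c \<in> charts_at A p"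
  shows "coord_vector A c p (r *\<^sub>R e) = (\<lambda>d. r *\<^sub>R coord_vector A c p e d)"
  using assms linear_transition_derivative[OF assms] by (auto simp: coord_vector_def linear_cmul)

lemma linear_covector_coords:
  assumes "covector A p \<beta>" "c \<in> charts_at A p"
  shows "linear (\<lambda>e. \<beta> (coord_vector A c p e))"
  by (rule linearI)
    (use assms coord_vector_mem[OF assms(2)] in \<open>simp_all add: covector_def coord_vector_add coord_vector_scale\<close>)

section \<open>The tangent bundle\<close>

definition tangent_chart :: "('a, 'e) chart \<Rightarrow> (('a, 'e) tm, 'e \<times> 'e) chart" where
  "tangent_chart c = ({(p, v). p \<in> fst c \<and> v \<in> tangent_space A p}, \<lambda>(p, v). (snd c p, v c))"

lemma tangent_bundle_eq: "tangent_bundle A = tangent_chart ` A"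
  by (simp add: tangent_bundle_def tangent_chart_def)

lemma mem_tangent_chart: "(p, v) \<in> fst (tangent_chart c) \<longleftrightarrow> p \<in> fst c \<and> v \<in> tangent_space A p"
  by (simp add: tangent_chart_def)

lemma tangent_chart_apply: "snd (tangent_chart c) (p, v) = (snd c p, v c)"
  by (simp add: tangent_chart_def)

lemma mem_carrier_tangent_bundle:
  "(p, v) \<in> carrier (tangent_bundle A) \<longleftrightarrow> p \<in> carrier A \<and> v \<in> tangent_space A p"
  by (auto simp: carrier_def tangent_bundle_eq mem_tangent_chart)

lemma charts_at_tangent_bundle:
  "v \<in> tangent_space A p \<Longrightarrow> charts_at (tangent_bundle A) (p, v) = tangent_chart ` charts_at A p"
  by (auto simp: charts_at_def tangent_bundle_eq mem_tangent_chart)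

lemma tangent_chart_charts_at:
  "v \<in> tangent_space A p \<Longrightarrow> c \<in> charts_at A p \<Longrightarrow> tangent_chart c \<in> charts_at (tangent_bundle A) (p, v)"
  by (simp add: charts_at_tangent_bundle)

text \<open>The fibre factor is the full model space because \<open>coord_vector\<close> realises
  every coordinate vector over every point.\<close>

lemma image_tangent_chart_overlap:
  assumes c: "c \<in> A"
  shows "snd (tangent_chart c) ` (fst (tangent_chart c) \<inter> fst (tangent_chart d)) = snd c ` (fst c \<inter> fst d) \<times> UNIV"
proof (intro equalityI subsetI)
  fix z assume "z \<in> snd (tangent_chart c) ` (fst (tangent_chart c) \<inter> fst (tangent_chart d))"
  then show "z \<in> snd c ` (fst c \<inter> fst d) \<times> UNIV"
    by (auto simp: tangent_chart_def)
next
  fix z assume "z \<in> snd c ` (fst c \<inter> fst d) \<times> (UNIV :: 'e set)"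
  then obtain p y where p: "p \<in> fst c" "p \<in> fst d" "z = (snd c p, y)" by auto
  have cp: "c \<in> charts_at A p" using c p by (intro charts_atI)
  show "z \<in> snd (tangent_chart c) ` (fst (tangent_chart c) \<inter> fst (tangent_chart d))"
    by (rule image_eqI[of _ _ "(p, coord_vector A c p y)"])
      (simp_all add: p mem_tangent_chart tangent_chart_apply coord_vector_self[OF cp] coord_vector_mem[OF cp])
qed

lemma image_tangent_chart: "c \<in> A \<Longrightarrow> snd (tangent_chart c) ` fst (tangent_chart c) = snd c ` fst c \<times> UNIV"
  using image_tangent_chart_overlap[of c c] by simp

lemma inj_on_tangent_chart:
  assumes c: "c \<in> A"
  shows "inj_on (snd (tangent_chart c)) (fst (tangent_chart c))"
proof (rule inj_onI, clarify)
  fix p v q w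
  assume *: "(p, v) \<in> fst (tangent_chart c)" "(q, w) \<in> fst (tangent_chart c)"
    "snd (tangent_chart c) (p, v) = snd (tangent_chart c) (q, w)"
  then have "snd c p = snd c q" "p \<in> fst c" "q \<in> fst c" by (simp_all add: tangent_chart_def)
  then have pq: "p = q" using chart_inv_chart[OF c] by metis
  then show "p = q \<and> v = w"
    using * tangent_space_eqI[of c p v w] charts_atI[OF c] by (simp add: tangent_chart_def)
qed

lemma chart_inv_tangent_chart:
  assumes c: "c \<in> A" and x: "x \<in> snd c ` fst c"
  shows "chart_inv (tangent_chart c) (x, y) = (chart_inv c x, coord_vector A c (chart_inv c x) y)"
proof -
  note cp = chart_inv_charts_at[OF c x]
  show ?thesis
    by (rule inv_into_f_eq[OF inj_on_tangent_chart[OF c]])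
      (use cp x in \<open>auto simp: mem_tangent_chart tangent_chart_apply coord_vector_self coord_vector_mem
        chart_chart_inv chart_inv_mem\<close>)
qed

lemma transition_tangent_chart:
  assumes c: "c \<in> A" and d: "d \<in> A" and x: "x \<in> snd c ` (fst c \<inter> fst d)"
  shows "transition (tangent_chart c) (tangent_chart d) (x, y)
    = (transition c d x, frechet_derivative (transition c d) (at x) y)"
proof -
  have x': "x \<in> snd c ` fst c" using x by auto
  have "chart_inv c x \<in> fst d" using x chart_inv_chart[OF c] by auto
  then have "d \<in> charts_at A (chart_inv c x)" by (rule charts_atI[OF d])
  then show ?thesis
    by (simp add: chart_inv_tangent_chart[OF c x'] tangent_chart_apply coord_vector_apply chart_chart_inv[OF x'])
qed

text \<open>A transition map of TM is a transition map of M paired with its derivative. With this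
  lemma the facts about atlases apply to TM and its tangent vectors as well.\<close>

lemma smooth_atlas_tangent_bundle: "smooth_atlas (tangent_bundle A)"
proof -
  have "smooth_on (snd c ` (fst c \<inter> fst d) \<times> UNIV) (transition (tangent_chart c) (tangent_chart d))"
    if c: "c \<in> A" and d: "d \<in> A" for c d
  proof (rule smooth_on_cong)
    let ?V = "snd c ` (fst c \<inter> fst d)"
    show V: "open (?V \<times> (UNIV :: 'e set))" by (intro open_Times open_overlap_image c d open_UNIV)
    show "smooth_on (?V \<times> UNIV) (\<lambda>z. (transition c d (fst z), frechet_derivative (transition c d) (at (fst z)) (snd z)))"
      by (intro smooth_on_Pair V smooth_on_compose[OF V smooth_on_fst smooth_on_transition[OF c d]]
          smooth_on_derivative_apply[OF smooth_on_transition[OF c d] V] smooth_on_fst smooth_on_snd) auto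
    show "(transition c d (fst z), frechet_derivative (transition c d) (at (fst z)) (snd z))
      = transition (tangent_chart c) (tangent_chart d) z" if "z \<in> ?V \<times> UNIV" for z
      using transition_tangent_chart[OF c d, of "fst z" "snd z"] that by auto
  qed
  then show ?thesis
    unfolding smooth_atlas_def tangent_bundle_eq
    by (auto simp: inj_on_tangent_chart image_tangent_chart image_tangent_chart_overlap
        intro!: open_Times open_chart_image open_overlap_image)
qed

text \<open>The base component changes like a tangent vector of M, while the fibre component also
  picks up second derivatives of the transition. This extra term is linear in \<open>a\<close>, so
  it vanishes on vertical vectors.\<close>

lemma transition_tangent_chart_derivative:
  assumes c: "c \<in> charts_at A p" and d: "d \<in> charts_at A p"
  shows "frechet_derivative (transition (tangent_chart c) (tangent_chart d)) (at (snd c p, y)) (a, b)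
    = (frechet_derivative (transition c d) (at (snd c p)) a,
       frechet_derivative (\<lambda>x. frechet_derivative (transition c d) (at x) y) (at (snd c p)) a
        + frechet_derivative (transition c d) (at (snd c p)) b)"
proof -
  note cA = charts_atD(1)[OF c] and dA = charts_atD(1)[OF d]
  let ?V = "snd c ` (fst c \<inter> fst d)"
  have V: "open ?V" by (intro open_overlap_image cA dA)
  have V': "open (?V \<times> (UNIV :: 'e set))" by (intro open_Times V open_UNIV)
  note p = charts_at_overlap[OF c d]
  have 1: "((\<lambda>z::'e \<times> 'e. transition c d (fst z)) has_derivative
      (\<lambda>h. frechet_derivative (transition c d) (at (snd c p)) (fst h))) (at (snd c p, y))"
    using diff_chain_at[OF has_derivative_fst[OF has_derivative_ident], of "transition c d" _ "(snd c p, y)"]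
      transition_has_derivative[OF c d] by (simp add: o_def)
  have 2: "((\<lambda>z. frechet_derivative (transition c d) (at (fst z)) (snd z)) has_derivative
      (\<lambda>h. frechet_derivative (\<lambda>x. frechet_derivative (transition c d) (at x) y) (at (snd c p)) (fst h)
        + frechet_derivative (transition c d) (at (snd c p)) (snd h))) (at (snd c p, y))"
    using has_derivative_derivative_apply[OF smooth_on_transition[OF cA dA] V _
        has_derivative_fst[OF has_derivative_ident] has_derivative_snd[OF has_derivative_ident], of "(snd c p, y)"] p
    by simp
  have "(transition (tangent_chart c) (tangent_chart d) has_derivative
      (\<lambda>h. (frechet_derivative (transition c d) (at (snd c p)) (fst h),
        frechet_derivative (\<lambda>x. frechet_derivative (transition c d) (at x) y) (at (snd c p)) (fst h)
        + frechet_derivative (transition c d) (at (snd c p)) (snd h)))) (at (snd c p, y))"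
  proof (rule has_derivative_transform_within_open[OF has_derivative_Pair[OF 1 2] V'])
    show "(snd c p, y) \<in> ?V \<times> UNIV" using p by simp
    show "(transition c d (fst z), frechet_derivative (transition c d) (at (fst z)) (snd z))
      = transition (tangent_chart c) (tangent_chart d) z" if "z \<in> ?V \<times> UNIV" for z
      using transition_tangent_chart[OF cA dA, of "fst z" "snd z"] that by auto
  qed
  from fun_cong[OF frechet_derivative_at[OF this], of "(a, b)"] show ?thesis by simp
qed

interpretation TB: atlas "tangent_bundle A"
  by unfold_locales (rule smooth_atlas_tangent_bundle)

text \<open>The chart chosen on TM need not be induced by the one chosen on M, but it is induced by
  some chart at \<open>p\<close>; the coordinate computations are made in that one.\<close>

lemma chart_of_tangent_bundle:
  assumes "(p, v) \<in> carrier (tangent_bundle A)"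
  obtains c where "c \<in> charts_at A p" "chart_of (tangent_bundle A) (p, v) = tangent_chart c"
  using chart_of_mem[OF assms] charts_at_tangent_bundle[of v p] assms
  by (auto simp: mem_carrier_tangent_bundle)

lemma tangent_bundle_carrierD:
  assumes "(p, v) \<in> carrier (tangent_bundle A)"
  shows "p \<in> carrier A" "v \<in> tangent_space A p"
  using assms by (simp_all add: mem_carrier_tangent_bundle)

lemma tangent_chart_point:
  assumes "c \<in> A" "z \<in> snd c ` fst c \<times> UNIV"
  obtains p v where "c \<in> charts_at A p" "(p, v) \<in> carrier (tangent_bundle A)" "z = (snd c p, v c)"
    "chart_inv (tangent_chart c) z = (p, v)"
proof -
  obtain x y where z: "z = (x, y)" "x \<in> snd c ` fst c" using assms by auto
  note cp = chart_inv_charts_at[OF assms(1) z(2)]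
  show ?thesis
    by (rule that[OF cp, of "coord_vector A c (chart_inv c x) y"])
      (simp_all add: z mem_carrier_tangent_bundle charts_at_carrier[OF cp] coord_vector_mem[OF cp] coord_vector_self[OF cp]
        chart_chart_inv chart_inv_tangent_chart[OF assms(1)])
qed

section \<open>Second order equations and horizontal forms in the charts of TM\<close>

lemma fst_ttm_transition:
  assumes v: "v \<in> tangent_space A p" and w: "w \<in> tangent_space (tangent_bundle A) (p, v)"
    and c: "c \<in> charts_at A p" and d: "d \<in> charts_at A p"
  shows "fst (w (tangent_chart d)) = frechet_derivative (transition c d) (at (snd c p)) (fst (w (tangent_chart c)))"
proof -
  obtain a b where ab: "w (tangent_chart c) = (a, b)" by fastforce
  have "w (tangent_chart d) = frechet_derivative (transition (tangent_chart c) (tangent_chart d)) (at (snd c p, v c)) (a, b)"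
    using TB.tangent_space_transition[OF w tangent_chart_charts_at[OF v c] tangent_chart_charts_at[OF v d]]
    by (simp add: ab tangent_chart_apply)
  then show ?thesis by (simp add: transition_tangent_chart_derivative[OF c d] ab)
qed

text \<open>The projection is linear in coordinates, so its differential reads off the base
  component. The definition does this in the chosen chart; the transformation law of base components
  carries it to an arbitrary \<open>c\<close>.\<close>

lemma tangent_map_fst:
  assumes q: "(p, v) \<in> carrier (tangent_bundle A)" and w: "w \<in> tangent_space (tangent_bundle A) (p, v)"
    and c: "c \<in> charts_at A p"
  shows "tangent_map (tangent_bundle A) A fst (p, v) w = coord_vector A c p (fst (w (tangent_chart c)))"
proof
  fix d
  show "tangent_map (tangent_bundle A) A fst (p, v) w d = coord_vector A c p (fst (w (tangent_chart c))) d"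
  proof (cases "d \<in> charts_at A p")
    case d: True
    note v = tangent_bundle_carrierD(2)[OF q]
    obtain k where k: "k \<in> charts_at A p" and ch: "chart_of (tangent_bundle A) (p, v) = tangent_chart k"
      by (rule chart_of_tangent_bundle[OF q])
    note kA = charts_atD(1)[OF k] and dA = charts_atD(1)[OF d]
    let ?V = "snd k ` (fst k \<inter> fst d)"
    have "((\<lambda>z::'e \<times> 'e. transition k d (fst z)) has_derivative
        (\<lambda>h. frechet_derivative (transition k d) (at (snd k p)) (fst h))) (at (snd k p, v k))"
      using diff_chain_at[OF has_derivative_fst[OF has_derivative_ident], of "transition k d" _ "(snd k p, v k)"]
        transition_has_derivative[OF k d] by (simp add: o_def)
    then have "(snd d \<circ> fst \<circ> chart_inv (tangent_chart k) has_derivative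
        (\<lambda>h. frechet_derivative (transition k d) (at (snd k p)) (fst h))) (at (snd k p, v k))"
    proof (rule has_derivative_transform_within_open)
      show "open (?V \<times> (UNIV :: 'e set))" by (intro open_Times open_overlap_image kA dA open_UNIV)
      show "(snd k p, v k) \<in> ?V \<times> UNIV" using charts_at_overlap[OF k d] by simp
      show "transition k d (fst z) = (snd d \<circ> fst \<circ> chart_inv (tangent_chart k)) z" if "z \<in> ?V \<times> UNIV" for z
        using chart_inv_tangent_chart[OF kA, of "fst z" "snd z"] that by auto
    qed
    note D = frechet_derivative_at[OF this, symmetric]
    have "tangent_map (tangent_bundle A) A fst (p, v) w d
      = frechet_derivative (transition k d) (at (snd k p)) (fst (w (tangent_chart k)))"
      using d by (simp add: tangent_map_def ch tangent_chart_apply D)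
    then show ?thesis
      by (simp add: fst_ttm_transition[OF v w k d, symmetric] fst_ttm_transition[OF v w c d] coord_vector_apply[OF d])
  next
    case False
    then show ?thesis by (simp add: tangent_map_def coord_vector_def)
  qed
qed

text \<open>One chart per point suffices, since one coordinate vector determines the projected
  vector.\<close>

lemma second_order_deI:
  assumes "vector_field (tangent_bundle A) D"
    and "\<And>p v. (p, v) \<in> carrier (tangent_bundle A) \<Longrightarrow> \<exists>c\<in>charts_at A p. fst (D (p, v) (tangent_chart c)) = v c"
  shows "second_order_de A D"
  unfolding second_order_de_def
proof (intro conjI assms(1) ballI, clarify)
  fix p v assume q: "(p, v) \<in> carrier (tangent_bundle A)"
  obtain c where c: "c \<in> charts_at A p" "fst (D (p, v) (tangent_chart c)) = v c" using assms(2)[OF q] by blast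
  have "D (p, v) \<in> tangent_space (tangent_bundle A) (p, v)" using assms(1) q by (simp add: vector_field_def)
  from tangent_map_fst[OF q this c(1)] show "tangent_map (tangent_bundle A) A fst (p, v) (D (p, v)) = v"
    by (simp add: c coord_vector_coords tangent_bundle_carrierD[OF q])
qed

lemma second_order_deD:
  assumes D: "second_order_de A D" and q: "(p, v) \<in> carrier (tangent_bundle A)" and c: "c \<in> charts_at A p"
  shows "fst (D (p, v) (tangent_chart c)) = v c"
proof -
  have "D (p, v) \<in> tangent_space (tangent_bundle A) (p, v)"
    using D q by (simp add: second_order_de_def vector_field_def)
  from tangent_map_fst[OF q this c] have "v = coord_vector A c p (fst (D (p, v) (tangent_chart c)))"
    using D q by (auto simp: second_order_de_def)
  then show ?thesis using coord_vector_self[OF c] by metis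
qed

lemma covector_coords_zero: "covector A p \<beta> \<Longrightarrow> c \<in> charts_at A p \<Longrightarrow> \<beta> (coord_vector A c p 0) = 0"
  using linear_0[OF linear_covector_coords] .

lemma horizontal_vertical:
  assumes h: "horizontal A \<alpha>" and q: "(p, v) \<in> carrier (tangent_bundle A)" and c: "c \<in> charts_at A p"
  shows "\<alpha> (p, v) (coord_vector (tangent_bundle A) (tangent_chart c) (p, v) (0, b)) = 0"
proof -
  note Tc = tangent_chart_charts_at[OF tangent_bundle_carrierD(2)[OF q] c]
  obtain \<beta> where \<beta>: "covector A p \<beta>" "\<And>w. w \<in> tangent_space (tangent_bundle A) (p, v) \<Longrightarrow>
      \<alpha> (p, v) w = \<beta> (tangent_map (tangent_bundle A) A fst (p, v) w)"
    using h q unfolding horizontal_def by force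
  show ?thesis
    by (simp add: \<beta>(2) TB.coord_vector_mem[OF Tc] tangent_map_fst[OF q TB.coord_vector_mem[OF Tc] c]
        TB.coord_vector_self[OF Tc] covector_coords_zero[OF \<beta>(1) c])
qed

lemma one_form_linear_coords:
  assumes "one_form (tangent_bundle A) \<alpha>" "(p, v) \<in> carrier (tangent_bundle A)" "c \<in> charts_at A p"
  shows "linear (\<lambda>e. \<alpha> (p, v) (coord_vector (tangent_bundle A) (tangent_chart c) (p, v) e))"
  using assms tangent_chart_charts_at[OF tangent_bundle_carrierD(2)[OF assms(2)] assms(3)]
  by (intro TB.linear_covector_coords) (auto simp: one_form_def)

lemma horizontalI:
  assumes \<alpha>: "one_form (tangent_bundle A) \<alpha>"
    and vert: "\<And>p v c b. (p, v) \<in> carrier (tangent_bundle A) \<Longrightarrow> c \<in> charts_at A p \<Longrightarrow>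
      \<alpha> (p, v) (coord_vector (tangent_bundle A) (tangent_chart c) (p, v) (0, b)) = 0"
  shows "horizontal A \<alpha>"
  unfolding horizontal_def
proof (rule ballI, clarify)
  fix p v assume q: "(p, v) \<in> carrier (tangent_bundle A)"
  obtain c where c: "c \<in> charts_at A p"
    using chart_of_mem[OF tangent_bundle_carrierD(1)[OF q]] by blast
  note Tc = tangent_chart_charts_at[OF tangent_bundle_carrierD(2)[OF q] c]
  define L where "L e = \<alpha> (p, v) (coord_vector (tangent_bundle A) (tangent_chart c) (p, v) e)" for e
  have L: "linear L" using one_form_linear_coords[OF \<alpha> q c] by (simp add: L_def[abs_def])
  have vert': "L (0, b) = 0" for b unfolding L_def by (rule vert[OF q c])
  show "\<exists>\<beta>. covector A p \<beta> \<and> (\<forall>w\<in>tangent_space (tangent_bundle A) (p, v).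
      \<alpha> (p, v) w = \<beta> (tangent_map (tangent_bundle A) A fst (p, v) w))"
  \<comment> \<open>The covector is \<open>L\<close> on vectors with fibre component 0;
    \<open>vert'\<close> says that this component does not matter.\<close>
  proof (intro exI[of _ "\<lambda>u. L (u c, 0)"] conjI ballI)
    show "covector A p (\<lambda>u. L (u c, 0))"
      using linear_add[OF L, of "(_, 0)" "(_, 0)"] linear_cmul[OF L, of _ "(_, 0)"] by (simp add: covector_def)
    fix w assume w: "w \<in> tangent_space (tangent_bundle A) (p, v)"
    have "\<alpha> (p, v) w = L (w (tangent_chart c))"
      by (simp add: L_def TB.coord_vector_coords[OF Tc w])
    also have "\<dots> = L (fst (w (tangent_chart c)), 0) + L (0, snd (w (tangent_chart c)))"
      using linear_add[OF L, of "(fst (w (tangent_chart c)), 0)" "(0, snd (w (tangent_chart c)))"] by simp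
    finally show "\<alpha> (p, v) w = L (tangent_map (tangent_bundle A) A fst (p, v) w c, 0)"
      by (simp add: vert' tangent_map_fst[OF q w c] coord_vector_self[OF c])
  qed
qed

text \<open>Moving a vertical vector to another chart leaves it vertical, so only the base component of
  a tangent vector matters to a horizontal form.\<close>

lemma horizontal_change_chart:
  assumes \<alpha>: "one_form (tangent_bundle A) \<alpha>" "horizontal A \<alpha>"
    and q: "(p, v) \<in> carrier (tangent_bundle A)" and c: "c \<in> charts_at A p" and d: "d \<in> charts_at A p"
  shows "\<alpha> (p, v) (coord_vector (tangent_bundle A) (tangent_chart c) (p, v) (a, 0))
    = \<alpha> (p, v) (coord_vector (tangent_bundle A) (tangent_chart d) (p, v)
        (frechet_derivative (transition c d) (at (snd c p)) a, 0))"
proof -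
  note v = tangent_bundle_carrierD(2)[OF q]
  note Tc = tangent_chart_charts_at[OF v c] and Td = tangent_chart_charts_at[OF v d]
  define L where "L e = \<alpha> (p, v) (coord_vector (tangent_bundle A) (tangent_chart d) (p, v) e)" for e
  have L: "linear L" using one_form_linear_coords[OF \<alpha>(1) q d] by (simp add: L_def[abs_def])
  obtain b where b: "frechet_derivative (transition (tangent_chart c) (tangent_chart d)) (at (snd c p, v c)) (a, 0)
      = (frechet_derivative (transition c d) (at (snd c p)) a, b)"
    using transition_tangent_chart_derivative[OF c d, of "v c" a 0] by blast
  have "\<alpha> (p, v) (coord_vector (tangent_bundle A) (tangent_chart c) (p, v) (a, 0))
      = L (frechet_derivative (transition c d) (at (snd c p)) a, b)"
    unfolding TB.coord_vector_change[OF Tc Td] by (simp add: L_def tangent_chart_apply b)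
  also have "\<dots> = L (frechet_derivative (transition c d) (at (snd c p)) a, 0) + L (0, b)"
    using linear_add[OF L, of "(frechet_derivative (transition c d) (at (snd c p)) a, 0)" "(0, b)"] by simp
  also have "L (0, b) = 0" unfolding L_def by (rule horizontal_vertical[OF \<alpha>(2) q d])
  finally show ?thesis by (simp only: L_def add_0_right)
qed

end

section \<open>The dynamics in coordinates\<close>

locale metric_atlas = atlas A for A :: "('a, 'e::euclidean_space) chart set" +
  fixes g :: "'a \<Rightarrow> ('a, 'e) tangent \<Rightarrow> ('a, 'e) tangent \<Rightarrow> real"
  assumes g: "pseudo_riemannian_metric A g"
begin

interpretation TB: atlas "tangent_bundle A"
  by unfold_locales (rule smooth_atlas_tangent_bundle)

text \<open>Expanding in a basis makes this bilinear even at the points \<open>x\<close> outside the image of the chart.\<close>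

definition metric_coord :: "('a, 'e) chart \<Rightarrow> 'e \<Rightarrow> 'e \<Rightarrow> 'e \<Rightarrow> real" where
  "metric_coord c x u v = (\<Sum>i\<in>Basis. \<Sum>j\<in>Basis. (u \<bullet> i) * (v \<bullet> j) *
     g (chart_inv c x) (coord_vector A c (chart_inv c x) i) (coord_vector A c (chart_inv c x) j))"

lemma bilinear_metric_coord: "bilinear (metric_coord c x)"
  unfolding metric_coord_def[abs_def] by (rule bilinear_coefficients)

lemma metric_symmetric: "p \<in> carrier A \<Longrightarrow> u \<in> tangent_space A p \<Longrightarrow> v \<in> tangent_space A p \<Longrightarrow> g p u v = g p v u"
  using g by (simp add: pseudo_riemannian_metric_def)

lemma metric_coord_vector:
  assumes c: "c \<in> charts_at A p"
  shows "g p (coord_vector A c p u) (coord_vector A c p v) = metric_coord c (snd c p) u v"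
proof -
  note p = charts_at_carrier[OF c] and mem = coord_vector_mem[OF c]
  have "linear (\<lambda>v. g p (coord_vector A c p u) (coord_vector A c p v))" for u
    using g p mem by (intro linear_covector_coords c) (auto simp: pseudo_riemannian_metric_def)
  \<comment> \<open>The definition of a metric gives linearity in the second argument; symmetry
    transfers it to the first.\<close>
  moreover from this have "linear (\<lambda>u. g p (coord_vector A c p u) (coord_vector A c p v))" for v
    by (subst metric_symmetric[OF p mem mem])
  ultimately have "bilinear (\<lambda>u v. g p (coord_vector A c p u) (coord_vector A c p v))"
    by (simp add: bilinear_def)
  from bilinear_basis_expansion[OF this, of u v] show ?thesis
    by (simp add: metric_coord_def chart_inv_chart[OF charts_atD[OF c]])
qed

lemma metric_eq_metric_coord:
  assumes "c \<in> charts_at A p" "u \<in> tangent_space A p" "v \<in> tangent_space A p"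
  shows "g p u v = metric_coord c (snd c p) (u c) (v c)"
  using metric_coord_vector[OF assms(1), of "u c" "v c"] assms by (simp add: coord_vector_coords)

lemma smooth_on_metric_coord:
  assumes "c \<in> A"
  shows "smooth_on (snd c ` fst c) (\<lambda>x. metric_coord c x u v)"
  unfolding metric_coord_def using g assms
  by (intro smooth_on_sum smooth_on_mult smooth_on_const open_chart_image[OF assms])
    (auto simp: pseudo_riemannian_metric_def)

lemma metric_coord_symmetric:
  assumes "c \<in> charts_at A p"
  shows "metric_coord c (snd c p) u v = metric_coord c (snd c p) v u"
  unfolding metric_coord_vector[OF assms, symmetric]
  by (intro metric_symmetric charts_at_carrier[OF assms] coord_vector_mem assms)

lemma metric_coord_nondegenerate:
  assumes c: "c \<in> charts_at A p" and "\<And>v. metric_coord c (snd c p) u v = 0"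
  shows "u = 0"
proof -
  have "g p (coord_vector A c p u) w = 0" if "w \<in> tangent_space A p" for w
    using metric_eq_metric_coord[OF c coord_vector_mem[OF c] that, of u] assms(2)
    by (simp add: coord_vector_self[OF c])
  then have "coord_vector A c p u = (\<lambda>c. 0)"
    using g charts_at_carrier[OF c] coord_vector_mem[OF c] by (simp add: pseudo_riemannian_metric_def)
  then show ?thesis using coord_vector_self[OF c, of u] by simp
qed

lemma metric_coord_change:
  assumes c: "c \<in> charts_at A p" and d: "d \<in> charts_at A p"
  shows "metric_coord c (snd c p) u v = metric_coord d (snd d p)
    (frechet_derivative (transition c d) (at (snd c p)) u) (frechet_derivative (transition c d) (at (snd c p)) v)"
  by (simp only: metric_coord_vector[OF c, symmetric] metric_coord_vector[OF d, symmetric] coord_vector_change[OF c d])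

abbreviation metric_deriv :: "('a, 'e) chart \<Rightarrow> 'e \<Rightarrow> 'e \<Rightarrow> 'e \<Rightarrow> 'e \<Rightarrow> real" where
  "metric_deriv c x u v \<equiv> frechet_derivative (\<lambda>x. metric_coord c x u v) (at x)"

lemma chart_mem_image: "c \<in> charts_at A p \<Longrightarrow> snd c p \<in> snd c ` fst c"
  by (auto dest: charts_atD)

lemma metric_coord_differentiable:
  "c \<in> A \<Longrightarrow> x \<in> snd c ` fst c \<Longrightarrow> (\<lambda>x. metric_coord c x u v) differentiable at x"
  by (rule smooth_on_differentiable[OF smooth_on_metric_coord])

lemma linear_metric_deriv: "c \<in> A \<Longrightarrow> x \<in> snd c ` fst c \<Longrightarrow> linear (metric_deriv c x u v)"
  by (rule smooth_on_linear_derivative[OF smooth_on_metric_coord])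

lemma bilinear_metric_deriv:
  "c \<in> A \<Longrightarrow> x \<in> snd c ` fst c \<Longrightarrow> bilinear (\<lambda>u v. metric_deriv c x u v h)"
  by (rule bilinear_frechet_derivative[OF bilinear_metric_coord metric_coord_differentiable])

lemma has_derivative_metric_coord:
  assumes "c \<in> A" "\<psi> z \<in> snd c ` fst c" "(\<psi> has_derivative \<psi>') (at z)"
    "(m has_derivative m') (at z)" "(n has_derivative n') (at z)"
  shows "((\<lambda>z. metric_coord c (\<psi> z) (m z) (n z)) has_derivative
    (\<lambda>h. metric_deriv c (\<psi> z) (m z) (n z) (\<psi>' h) + metric_coord c (\<psi> z) (m' h) (n z)
      + metric_coord c (\<psi> z) (m z) (n' h))) (at z)"
  by (intro has_derivative_bilinear_family bilinear_metric_coord metric_coord_differentiable assms)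

text \<open>Differentiates the tensor law \<open>metric_coord_change\<close> along the chart. The
  Jacobian moves with the point, and each of its two occurrences contributes a term with second
  derivatives \<open>H\<close>.\<close>

lemma metric_deriv_change:
  assumes c: "c \<in> charts_at A p" and d: "d \<in> charts_at A p"
  defines "J \<equiv> frechet_derivative (transition c d) (at (snd c p))"
    and "H \<equiv> \<lambda>u. frechet_derivative (\<lambda>x. frechet_derivative (transition c d) (at x) u) (at (snd c p))"
  shows "metric_deriv c (snd c p) u v h = metric_deriv d (snd d p) (J u) (J v) (J h)
    + metric_coord d (snd d p) (H u h) (J v) + metric_coord d (snd d p) (J u) (H v h)"
proof -
  note cA = charts_atD(1)[OF c] and dA = charts_atD(1)[OF d]
  let ?V = "snd c ` (fst c \<inter> fst d)"
  let ?J = "\<lambda>x. frechet_derivative (transition c d) (at x)"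
  have cd: "transition c d (snd c p) = snd d p" by (rule transition_chart[OF charts_atD[OF c]])
  have H: "((\<lambda>x. ?J x u) has_derivative H u) (at (snd c p))" for u
    unfolding H_def
    by (rule smooth_on_has_derivative[OF smooth_on_frechet_derivative[OF smooth_on_transition[OF cA dA]] charts_at_overlap[OF c d]])
  have "((\<lambda>x. metric_coord d (transition c d x) (?J x u) (?J x v)) has_derivative
      (\<lambda>h. metric_deriv d (transition c d (snd c p)) (J u) (J v) (J h)
        + metric_coord d (transition c d (snd c p)) (H u h) (J v)
        + metric_coord d (transition c d (snd c p)) (J u) (H v h))) (at (snd c p))"
    unfolding J_def by (intro has_derivative_metric_coord dA transition_has_derivative c d H) (simp only: cd chart_mem_image[OF d])
  then have "((\<lambda>x. metric_coord c x u v) has_derivative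
      (\<lambda>h. metric_deriv d (transition c d (snd c p)) (J u) (J v) (J h)
        + metric_coord d (transition c d (snd c p)) (H u h) (J v)
        + metric_coord d (transition c d (snd c p)) (J u) (H v h))) (at (snd c p))"
  proof (rule has_derivative_transform_within_open[OF _ open_overlap_image[OF cA dA] charts_at_overlap[OF c d]])
    fix x assume "x \<in> ?V"
    then obtain r where r: "x = snd c r" "c \<in> charts_at A r" "d \<in> charts_at A r"
      using cA dA by (auto intro: charts_atI)
    show "metric_coord d (transition c d x) (?J x u) (?J x v) = metric_coord c x u v"
      unfolding r(1) metric_coord_change[OF r(2,3)] transition_chart[OF charts_atD[OF r(2)]] ..
  qed
  from fun_cong[OF frechet_derivative_at[OF this], of h] show ?thesis by (simp only: cd)
qed

section \<open>Kinetic energy, Liouville form and symplectic form in coordinates\<close>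

lemma kinetic_energy_coord:
  assumes "c \<in> A" "x \<in> snd c ` fst c"
  shows "kinetic_energy g (chart_inv (tangent_chart c) (x, y)) = metric_coord c x y y / 2"
  using metric_coord_vector[OF chart_inv_charts_at[OF assms], of y y]
  by (simp add: kinetic_energy_def chart_inv_tangent_chart[OF assms] chart_chart_inv[OF assms(2)])

lemma differential_kinetic_energy:
  assumes q: "(p, v) \<in> carrier (tangent_bundle A)" and c: "c \<in> charts_at A p"
    and ch: "chart_of (tangent_bundle A) (p, v) = tangent_chart c"
    and w: "w (tangent_chart c) = (a, b)"
  shows "differential (tangent_bundle A) (kinetic_energy g) (p, v) w
    = metric_deriv c (snd c p) (v c) (v c) a / 2 + metric_coord c (snd c p) (v c) b"
proof -
  note cA = charts_atD(1)[OF c]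
  have "((\<lambda>z. metric_coord c (fst z) (snd z) (snd z) / 2) has_derivative
      (\<lambda>h. (metric_deriv c (fst (snd c p, v c)) (snd (snd c p, v c)) (snd (snd c p, v c)) (fst h)
        + metric_coord c (fst (snd c p, v c)) (snd h) (snd (snd c p, v c))
        + metric_coord c (fst (snd c p, v c)) (snd (snd c p, v c)) (snd h)) / 2)) (at (snd c p, v c))"
    by (intro bounded_linear.has_derivative[OF bounded_linear_divide] has_derivative_metric_coord cA has_derivative_fst has_derivative_snd has_derivative_ident)
      (simp add: chart_mem_image[OF c])
  then have "((kinetic_energy g \<circ> chart_inv (tangent_chart c)) has_derivative
      (\<lambda>h. (metric_deriv c (snd c p) (v c) (v c) (fst h) + metric_coord c (snd c p) (snd h) (v c)
        + metric_coord c (snd c p) (v c) (snd h)) / 2)) (at (snd c p, v c))"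
    unfolding fst_conv snd_conv
  proof (rule has_derivative_transform_within_open)
    show "open (snd c ` fst c \<times> (UNIV :: 'e set))" by (intro open_Times open_chart_image cA open_UNIV)
    show "(snd c p, v c) \<in> snd c ` fst c \<times> UNIV" using chart_mem_image[OF c] by simp
    show "metric_coord c (fst z) (snd z) (snd z) / 2 = (kinetic_energy g \<circ> chart_inv (tangent_chart c)) z"
      if "z \<in> snd c ` fst c \<times> UNIV" for z
      using kinetic_energy_coord[OF cA, of "fst z" "snd z"] that by auto
  qed
  from fun_cong[OF frechet_derivative_at[OF this], of "(a, b)"] show ?thesis
    by (simp add: differential_def Let_def ch tangent_chart_apply w metric_coord_symmetric[OF c, of b])
qed

text \<open>In classical notation the Liouville form is g_ij y^i dx^j, without dy terms.\<close>

lemma liouville_form_coord: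
  assumes c: "c \<in> A" and x: "x \<in> snd c ` fst c"
  shows "liouville_form A g (chart_inv (tangent_chart c) (x, y))
    (coord_vector (tangent_bundle A) (tangent_chart c) (chart_inv (tangent_chart c) (x, y)) e) = metric_coord c x y (fst e)"
proof -
  note cp = chart_inv_charts_at[OF c x]
  let ?p = "chart_inv c x" let ?v = "coord_vector A c ?p y"
  have q: "(?p, ?v) \<in> carrier (tangent_bundle A)"
    by (simp add: mem_carrier_tangent_bundle charts_at_carrier[OF cp] coord_vector_mem[OF cp])
  note Tc = tangent_chart_charts_at[OF tangent_bundle_carrierD(2)[OF q] cp]
  show ?thesis
    by (simp add: chart_inv_tangent_chart[OF c x] liouville_form_def tangent_map_fst[OF q TB.coord_vector_mem[OF Tc] cp]
      TB.coord_vector_self[OF Tc] metric_coord_vector[OF cp] chart_chart_inv[OF x])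
qed

text \<open>The coefficients of the Liouville form are linear in the velocity. Differentiating them
  gives metric terms that pair a fibre component with a base component, and no term pairing two
  fibre components.\<close>

lemma symplectic_form_coord:
  assumes q: "(p, v) \<in> carrier (tangent_bundle A)" and c: "c \<in> charts_at A p"
    and ch: "chart_of (tangent_bundle A) (p, v) = tangent_chart c"
    and u: "u (tangent_chart c) = (a, b)" and w: "w (tangent_chart c) = (a', b')"
  shows "symplectic_form A g (p, v) u w
    = metric_deriv c (snd c p) (v c) a' a + metric_coord c (snd c p) b a'
      - (metric_deriv c (snd c p) (v c) a a' + metric_coord c (snd c p) b' a)"
proof -
  note cA = charts_atD(1)[OF c]
  define L where "L = (\<lambda>e z. liouville_form A g (chart_inv (tangent_chart c) z)
    (coord_vector (tangent_bundle A) (tangent_chart c) (chart_inv (tangent_chart c) z) e))"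
  have L: "frechet_derivative (L e) (at (snd c p, v c)) h
    = metric_deriv c (snd c p) (v c) (fst e) (fst h) + metric_coord c (snd c p) (snd h) (fst e)" for e h
  proof -
    have "((\<lambda>z. metric_coord c (fst z) (snd z) (fst e)) has_derivative
        (\<lambda>h. metric_deriv c (fst (snd c p, v c)) (snd (snd c p, v c)) (fst e) (fst h)
          + metric_coord c (fst (snd c p, v c)) (snd h) (fst e)
          + metric_coord c (fst (snd c p, v c)) (snd (snd c p, v c)) 0)) (at (snd c p, v c))"
      by (intro has_derivative_metric_coord cA has_derivative_fst has_derivative_snd has_derivative_ident has_derivative_const)
        (simp add: chart_mem_image[OF c])
    then have "(L e has_derivative
        (\<lambda>h. metric_deriv c (snd c p) (v c) (fst e) (fst h) + metric_coord c (snd c p) (snd h) (fst e)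
          + metric_coord c (snd c p) (v c) 0)) (at (snd c p, v c))"
      unfolding fst_conv snd_conv
    proof (rule has_derivative_transform_within_open)
      show "open (snd c ` fst c \<times> (UNIV :: 'e set))" by (intro open_Times open_chart_image cA open_UNIV)
      show "(snd c p, v c) \<in> snd c ` fst c \<times> UNIV" using chart_mem_image[OF c] by simp
      show "metric_coord c (fst z) (snd z) (fst e) = L e z" if "z \<in> snd c ` fst c \<times> UNIV" for z
        using liouville_form_coord[OF cA, of "fst z" "snd z" e] that by (auto simp: L_def)
    qed
    from fun_cong[OF frechet_derivative_at[OF this], of h] show ?thesis
      by (simp add: bilinear_rzero[OF bilinear_metric_coord])
  qed
  show ?thesis
    using L[of "(a', b')" "(a, b)"] L[of "(a, b)" "(a', b')"]
    by (simp add: symplectic_form_def exterior_derivative_def ch u w tangent_chart_apply L_def)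
qed

section \<open>The second order equation with a prescribed work form\<close>

definition form_coord :: "(('a, 'e) tm \<Rightarrow> ('a, 'e) ttm \<Rightarrow> real) \<Rightarrow> ('a, 'e) chart \<Rightarrow> 'e \<times> 'e \<Rightarrow> 'e \<times> 'e \<Rightarrow> real" where
  "form_coord \<alpha> c z e = \<alpha> (chart_inv (tangent_chart c) z)
     (coord_vector (tangent_bundle A) (tangent_chart c) (chart_inv (tangent_chart c) z) e)"

text \<open>In coordinates \<open>(x, y)\<close> on \<open>TM\<close>, a second order equation \<open>D = (y, F)\<close> has work form \<open>\<alpha>\<close> exactly
  when \<open>G\<^sub>x(F, a) = D\<^sub>a G(y, y) / 2 - D\<^sub>y G(y, a) - \<alpha>(a, 0)\<close> for all \<open>a\<close>.\<close>

definition force_rhs :: "(('a, 'e) tm \<Rightarrow> ('a, 'e) ttm \<Rightarrow> real) \<Rightarrow> ('a, 'e) chart \<Rightarrow> 'e \<times> 'e \<Rightarrow> 'e \<Rightarrow> real" where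
  "force_rhs \<alpha> c z a = metric_deriv c (fst z) (snd z) (snd z) a / 2
     - metric_deriv c (fst z) (snd z) a (snd z) - form_coord \<alpha> c z (a, 0)"

definition force :: "(('a, 'e) tm \<Rightarrow> ('a, 'e) ttm \<Rightarrow> real) \<Rightarrow> ('a, 'e) chart \<Rightarrow> 'e \<times> 'e \<Rightarrow> 'e" where
  "force \<alpha> c z = (THE F. \<forall>a. metric_coord c (fst z) F a = force_rhs \<alpha> c z a)"

text \<open>Building the value in one chosen chart makes it a tangent vector by construction; that
  every chart yields the same vector is the content of \<open>force_change\<close>.\<close>

definition dynamics :: "(('a, 'e) tm \<Rightarrow> ('a, 'e) ttm \<Rightarrow> real) \<Rightarrow> ('a, 'e) tm \<Rightarrow> ('a, 'e) ttm" where
  "dynamics \<alpha> q = (let c = chart_of A (fst q) in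
     coord_vector (tangent_bundle A) (tangent_chart c) q (snd q c, force \<alpha> c (snd (tangent_chart c) q)))"

lemma form_coord_chart:
  assumes "c \<in> charts_at A p" "v \<in> tangent_space A p"
  shows "form_coord \<alpha> c (snd c p, v c) e
    = \<alpha> (p, v) (coord_vector (tangent_bundle A) (tangent_chart c) (p, v) e)"
  using assms
  by (simp add: form_coord_def chart_inv_tangent_chart charts_atD chart_inv_chart coord_vector_coords)

context
  fixes \<alpha> :: "('a, 'e) tm \<Rightarrow> ('a, 'e) ttm \<Rightarrow> real"
  assumes \<alpha>: "one_form (tangent_bundle A) \<alpha>" "horizontal A \<alpha>"
begin

lemma linear_force_rhs:
  assumes q: "(p, v) \<in> carrier (tangent_bundle A)" and c: "c \<in> charts_at A p"
  shows "linear (force_rhs \<alpha> c (snd c p, v c))"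
proof -
  note cA = charts_atD(1)[OF c] and x = chart_mem_image[OF c]
  define L where "L e = form_coord \<alpha> c (snd c p, v c) e" for e
  have L: "linear L"
    unfolding L_def form_coord_chart[OF c tangent_bundle_carrierD(2)[OF q]] by (rule one_form_linear_coords[OF \<alpha>(1) q c])
  note l1 = linear_metric_deriv[OF cA x, of "v c" "v c"]
  have l2: "linear (\<lambda>a. metric_deriv c (snd c p) (v c) a (v c))"
    using bilinear_metric_deriv[OF cA x, of "v c"] by (simp add: bilinear_def)
  show ?thesis
    by (rule linearI)
      (use linear_add[OF L, of "(_, 0)" "(_, 0)"] linear_cmul[OF L, of _ "(_, 0)"] in
        \<open>simp_all add: force_rhs_def L_def[symmetric] linear_add[OF l1] linear_cmul[OF l1]
          linear_add[OF l2] linear_cmul[OF l2] field_simps\<close>)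
qed

lemma force_unique:
  assumes q: "(p, v) \<in> carrier (tangent_bundle A)" and c: "c \<in> charts_at A p"
  shows "\<exists>!F. \<forall>a. metric_coord c (snd c p) F a = force_rhs \<alpha> c (snd c p, v c) a"
  by (rule nondegenerate_ex1[OF bilinear_metric_coord metric_coord_nondegenerate[OF c] linear_force_rhs[OF q c]])

lemma metric_coord_force:
  assumes q: "(p, v) \<in> carrier (tangent_bundle A)" and c: "c \<in> charts_at A p"
  shows "metric_coord c (snd c p) (force \<alpha> c (snd c p, v c)) a = force_rhs \<alpha> c (snd c p, v c) a"
  using theI'[OF force_unique[OF q c]] by (simp add: force_def)

lemma force_eqI:
  assumes q: "(p, v) \<in> carrier (tangent_bundle A)" and c: "c \<in> charts_at A p"
    and F: "\<And>a. metric_coord c (snd c p) F a = force_rhs \<alpha> c (snd c p, v c) a"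
  shows "force \<alpha> c (snd c p, v c) = F"
  using force_unique[OF q c] metric_coord_force[OF q c] F by blast

lemma smooth_on_force:
  assumes c: "c \<in> A"
  shows "smooth_on (snd c ` fst c \<times> UNIV) (force \<alpha> c)"
proof (rule smooth_on_solve_bilinear)
  let ?S = "snd c ` fst c \<times> (UNIV :: 'e set)"
  show S: "open ?S" by (intro open_Times open_chart_image c open_UNIV)
  have fst_S: "fst ` ?S \<subseteq> snd c ` fst c" by auto
  show "smooth_on ?S (\<lambda>z. metric_coord c (fst z) i j)" for i j
    by (rule smooth_on_compose[OF S smooth_on_fst smooth_on_metric_coord[OF c] fst_S])
  show "bilinear (metric_coord c (fst z))" for z by (rule bilinear_metric_coord)
  have D: "smooth_on (snd c ` fst c) (\<lambda>x. metric_deriv c x u v h)" for u v h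
    by (rule smooth_on_frechet_derivative[OF smooth_on_metric_coord[OF c]])
  show "smooth_on ?S (\<lambda>z. force_rhs \<alpha> c z j)" for j
    unfolding force_rhs_def
  proof (intro smooth_on_diff S)
    have "smooth_on ?S (\<lambda>z. metric_deriv c (fst z) (snd z) (snd z) j)"
      by (rule smooth_on_bilinear_family[where \<Gamma>="\<lambda>x u v. metric_deriv c x u v j",
            OF bilinear_metric_deriv[OF c] D S smooth_on_fst fst_S smooth_on_snd smooth_on_snd])
    then show "smooth_on ?S (\<lambda>z. metric_deriv c (fst z) (snd z) (snd z) j / 2)"
      by (intro smooth_on_compose_linear[OF bounded_linear_divide S])
    \<comment> \<open>Here the velocity fills one slot of the metric and the direction of
      differentiation, so the bilinear family is taken in this pair, with \<open>j\<close>
      fixed.\<close>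
    show "smooth_on ?S (\<lambda>z. metric_deriv c (fst z) (snd z) j (snd z))"
    proof (rule smooth_on_bilinear_family[where \<Gamma>="\<lambda>x u h. metric_deriv c x u j h",
            OF _ D S smooth_on_fst fst_S smooth_on_snd smooth_on_snd])
      fix x assume "x \<in> snd c ` fst c"
      then show "bilinear (\<lambda>u h. metric_deriv c x u j h)"
        using linear_metric_deriv[OF c] bilinear_metric_deriv[OF c] by (simp add: bilinear_def)
    qed
    have "tangent_chart c \<in> tangent_bundle A" using c by (simp add: tangent_bundle_eq)
    then show "smooth_on ?S (\<lambda>z. form_coord \<alpha> c z (j, 0))"
      using \<alpha>(1) unfolding one_form_def form_coord_def image_tangent_chart[OF c, symmetric] by blast
  qed
  fix z assume z: "z \<in> ?S"
  then obtain p v where p: "c \<in> charts_at A p" "(p, v) \<in> carrier (tangent_bundle A)" "z = (snd c p, v c)"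
    using tangent_chart_point[OF c] by blast
  show "u = 0" if "\<And>v. metric_coord c (fst z) u v = 0" for u
    by (rule metric_coord_nondegenerate[OF p(1)]) (use that p(3) in simp)
  show "metric_coord c (fst z) (force \<alpha> c z) j = force_rhs \<alpha> c z j" for j
    using metric_coord_force[OF p(2,1)] by (simp add: p(3))
qed

text \<open>The second derivatives of the change of coordinates enter both sides; they cancel because they
  are symmetric.\<close>

lemma force_change:
  assumes q: "(p, v) \<in> carrier (tangent_bundle A)" and c: "c \<in> charts_at A p" and d: "d \<in> charts_at A p"
  shows "force \<alpha> d (snd d p, v d)
    = frechet_derivative (\<lambda>x. frechet_derivative (transition c d) (at x) (v c)) (at (snd c p)) (v c)
      + frechet_derivative (transition c d) (at (snd c p)) (force \<alpha> c (snd c p, v c))"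
proof (rule force_eqI[OF q d])
  fix a'
  note v = tangent_bundle_carrierD(2)[OF q]
  note cA = charts_atD(1)[OF c] and dA = charts_atD(1)[OF d]
  define J where "J = frechet_derivative (transition c d) (at (snd c p))"
  define H where "H u = frechet_derivative (\<lambda>x. frechet_derivative (transition c d) (at x) u) (at (snd c p))" for u
  define G where "G = metric_coord d (snd d p)"
  define y where "y = v c"
  define F where "F = force \<alpha> c (snd c p, v c)"
  \<comment> \<open>The test vector \<open>a'\<close> is carried back to the chart \<open>c\<close>,
    so that \<open>J a = a'\<close>.\<close>
  define a where "a = frechet_derivative (transition d c) (at (snd d p)) a'"
  have Ja: "J a = a'"
    unfolding J_def a_def transition_derivative_compose[OF d c d] by (rule transition_derivative_self[OF d])
  have Jy: "v d = J y"
    unfolding J_def y_def by (rule tangent_space_transition[OF v c d])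
  have H_sym: "H y a = H a y"
    unfolding H_def
    by (rule second_derivative_symmetric[OF open_overlap_image[OF cA dA] smooth_on_transition[OF cA dA] charts_at_overlap[OF c d]])
  have G_sym: "G u w = G w u" for u w
    unfolding G_def by (rule metric_coord_symmetric[OF d])
  have G_add: "G (u + w) z = G u z + G w z" for u w z
    unfolding G_def by (rule bilinear_ladd[OF bilinear_metric_coord])
  note change = metric_deriv_change[OF c d, folded J_def H_def G_def]
  have form: "form_coord \<alpha> c (snd c p, y) (a, 0) = form_coord \<alpha> d (snd d p, J y) (a', 0)"
    using horizontal_change_chart[OF \<alpha> q c d, of a]
    unfolding J_def[symmetric] Ja form_coord_chart[OF c v, symmetric] form_coord_chart[OF d v, symmetric] Jy
    by (simp only: y_def)
  have "G (H y y + J F) a' = G (H y y) a' + metric_coord c (snd c p) F a"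
    using metric_coord_change[OF c d, folded J_def G_def, of F a] by (simp add: G_add Ja)
  also have "metric_coord c (snd c p) F a = force_rhs \<alpha> c (snd c p, y) a"
    unfolding F_def y_def by (rule metric_coord_force[OF q c])
  \<comment> \<open>\<open>G (H y y) a'\<close> cancels against the derivative of
    \<open>G(y, a)\<close> along \<open>y\<close>. The remaining terms with \<open>H y a\<close> and
    \<open>H a y\<close> cancel by the symmetry of \<open>H\<close> and of \<open>G\<close>; the
    factor 1/2 is compensated by the two equal terms from \<open>G(y, y)\<close>.\<close>
  also have "G (H y y) a' + force_rhs \<alpha> c (snd c p, y) a = force_rhs \<alpha> d (snd d p, J y) a'"
    unfolding force_rhs_def form fst_conv snd_conv change[of y y a] change[of y a y] Ja H_sym
    using G_sym[of "H a y" "J y"] by (simp add: field_simps)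
  finally show "G (H y y + J F) a' = force_rhs \<alpha> d (snd d p, v d) a'" 
    by (simp only: Jy)
qed

lemma dynamics_mem: 
  assumes q: "(p, v) \<in> carrier (tangent_bundle A)"
  shows "dynamics \<alpha> (p, v) \<in> tangent_space (tangent_bundle A) (p, v)"
  unfolding dynamics_def Let_def
  by (intro TB.coord_vector_mem) (simp add: tangent_chart_charts_at chart_of_mem tangent_bundle_carrierD[OF q])

text \<open>The transformation law of \<open>force\<close> is exactly that of the fibre component of
  a tangent vector of TM with base component \<open>v c\<close>.\<close>

lemma dynamics_coord:
  assumes q: "(p, v) \<in> carrier (tangent_bundle A)" and d: "d \<in> charts_at A p"
  shows "dynamics \<alpha> (p, v) (tangent_chart d) = (v d, force \<alpha> d (snd d p, v d))"
proof -
  note v = tangent_bundle_carrierD(2)[OF q]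
  define c where "c = chart_of A p"
  have c: "c \<in> charts_at A p" unfolding c_def by (rule chart_of_mem[OF tangent_bundle_carrierD(1)[OF q]])
  note Tc = tangent_chart_charts_at[OF v c] and Td = tangent_chart_charts_at[OF v d]
  show ?thesis
    unfolding dynamics_def Let_def fst_conv snd_conv c_def[symmetric] TB.coord_vector_apply[OF Td] tangent_chart_apply
      transition_tangent_chart_derivative[OF c d] force_change[OF q c d]
    unfolding tangent_space_transition[OF v c d] ..
qed

lemma second_order_de_dynamics: "second_order_de A (dynamics \<alpha>)"
proof (rule second_order_deI)
  show "vector_field (tangent_bundle A) (dynamics \<alpha>)"
    unfolding vector_field_def
  proof (intro conjI ballI)
    fix q assume "q \<in> carrier (tangent_bundle A)"
    then show "dynamics \<alpha> q \<in> tangent_space (tangent_bundle A) q"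
      using dynamics_mem by (cases q) simp
  next
    fix C assume "C \<in> tangent_bundle A"
    then obtain c where c: "c \<in> A" and C: "C = tangent_chart c" by (auto simp: tangent_bundle_eq)
    have S: "open (snd c ` fst c \<times> (UNIV :: 'e set))" by (intro open_Times open_chart_image c open_UNIV)
    show "smooth_on (snd C ` fst C) (\<lambda>z. dynamics \<alpha> (chart_inv C z) C)"
      unfolding C image_tangent_chart[OF c]
    proof (rule smooth_on_cong[OF S smooth_on_Pair[OF S smooth_on_snd smooth_on_force[OF c]]])
      fix z assume "z \<in> snd c ` fst c \<times> (UNIV :: 'e set)"
      then obtain p v where "c \<in> charts_at A p" "(p, v) \<in> carrier (tangent_bundle A)" "z = (snd c p, v c)"
        "chart_inv (tangent_chart c) z = (p, v)" using tangent_chart_point[OF c] by metis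
      then show "(snd z, force \<alpha> c z) = dynamics \<alpha> (chart_inv (tangent_chart c) z) (tangent_chart c)"
        by (simp add: dynamics_coord)
    qed
  qed
  fix p v assume q: "(p, v) \<in> carrier (tangent_bundle A)"
  show "\<exists>c\<in>charts_at A p. fst (dynamics \<alpha> (p, v) (tangent_chart c)) = v c"
    using dynamics_coord[OF q] by (intro bexI[OF _ chart_of_mem[OF tangent_bundle_carrierD(1)[OF q]]])
      (simp add: chart_of_mem tangent_bundle_carrierD[OF q])
qed

text \<open>The fibre component \<open>b\<close> of the test vector contributes -G(b, y) to the
  symplectic term and G(y, b) to the differential of the kinetic energy. These cancel, and what is
  left, in \<open>a\<close> alone, is the equation that defines the force.\<close>

lemma work_form_dynamics: "work_form A g (dynamics \<alpha>) \<alpha>"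
  unfolding work_form_def
proof (intro conjI \<alpha> ballI)
  fix q w assume "q \<in> carrier (tangent_bundle A)" and w: "w \<in> tangent_space (tangent_bundle A) q"
  moreover obtain p v where pv: "q = (p, v)" by fastforce
  ultimately have q: "(p, v) \<in> carrier (tangent_bundle A)" and w: "w \<in> tangent_space (tangent_bundle A) (p, v)" by simp_all
  obtain c where c: "c \<in> charts_at A p" and ch: "chart_of (tangent_bundle A) (p, v) = tangent_chart c"
    by (rule chart_of_tangent_bundle[OF q])
  note v = tangent_bundle_carrierD(2)[OF q]
  note Tc = tangent_chart_charts_at[OF v c]
  obtain a b where ab: "w (tangent_chart c) = (a, b)" by fastforce
  define L where "L e = form_coord \<alpha> c (snd c p, v c) e" for e
  have L: "linear L"
    unfolding L_def form_coord_chart[OF c v] by (rule one_form_linear_coords[OF \<alpha>(1) q c])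
  have "L (0, b) = 0"
    unfolding L_def form_coord_chart[OF c v] by (rule horizontal_vertical[OF \<alpha>(2) q c])
  then have "L (a, b) = L (a, 0)"
    using linear_add[OF L, of "(a, 0)" "(0, b)"] by simp
  moreover have "\<alpha> (p, v) w = L (a, b)"
    unfolding L_def form_coord_chart[OF c v] ab[symmetric] TB.coord_vector_coords[OF Tc w] ..
  ultimately have \<alpha>w: "\<alpha> (p, v) w = form_coord \<alpha> c (snd c p, v c) (a, 0)" by (simp add: L_def)
  show "symplectic_form A g q (dynamics \<alpha> q) w + differential (tangent_bundle A) (kinetic_energy g) q w + \<alpha> q w = 0"
    unfolding pv symplectic_form_coord[where u="dynamics \<alpha> (p, v)" and w=w, OF q c ch dynamics_coord[OF q c] ab]
      differential_kinetic_energy[where w=w, OF q c ch ab] \<alpha>w metric_coord_force[OF q c]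
    by (simp add: force_rhs_def metric_coord_symmetric[OF c, of b])
qed

end

end

section \<open>Contact forms are horizontal\<close>

context atlas
begin

interpretation TB: atlas "tangent_bundle A"
  by unfold_locales (rule smooth_atlas_tangent_bundle)

section \<open>Cutoff functions and vertical fields on the whole manifold\<close>

lemma topspace_atlas_topology: "topspace (atlas_topology A) = carrier A"
proof
  show "topspace (atlas_topology A) \<subseteq> carrier A"
    using openin_topspace[of "atlas_topology A"] unfolding openin_atlas_topology[OF A] by blast
  have "carrier A \<inter> fst c = fst c" if "c \<in> A" for c using that by (auto simp: carrier_def)
  then have "openin (atlas_topology A) (carrier A)"
    unfolding openin_atlas_topology[OF A] by (simp add: open_chart_image)
  then show "carrier A \<subseteq> topspace (atlas_topology A)" by (rule openin_subset)
qed

text \<open>Carries compact sets of the model space to compact sets of the manifold.\<close>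

lemma continuous_map_chart_inv:
  assumes c: "c \<in> A"
  shows "continuous_map (top_of_set (snd c ` fst c)) (atlas_topology A) (chart_inv c)"
  unfolding continuous_map_def topspace_atlas_topology topspace_euclidean_subtopology
proof (intro conjI allI impI Pi_I)
  fix x assume "x \<in> snd c ` fst c"
  then show "chart_inv c x \<in> carrier A" using c chart_inv_mem[of x c] by (auto simp: carrier_def)
next
  fix W assume W: "openin (atlas_topology A) W"
  have "{x \<in> snd c ` fst c. chart_inv c x \<in> W} = snd c ` (W \<inter> fst c)"
    using chart_inv_chart[OF c] by auto
  moreover have "open (snd c ` (W \<inter> fst c))" using W c by (simp add: openin_atlas_topology[OF A])
  ultimately show "openin (top_of_set (snd c ` fst c)) {x \<in> snd c ` fst c. chart_inv c x \<in> W}"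
    by (auto intro: open_openin_trans[OF open_chart_image[OF c]])
qed

text \<open>\<open>K\<close> is the image of a closed ball in the chart. Its complement is open and,
  together with the domain of \<open>c\<close>, covers the manifold, so data multiplied by the bump
  can be continued by 0.\<close>

lemma manifold_bump:
  assumes H: "Hausdorff_space (atlas_topology A)" and c: "c \<in> charts_at A p"
  obtains \<rho> :: "'e \<Rightarrow> real" and K where "smooth_on UNIV \<rho>" "\<rho> (snd c p) \<noteq> 0"
    "closedin (atlas_topology A) K" "K \<subseteq> fst c" "\<forall>r\<in>fst c - K. \<rho> (snd c r) = 0"
proof -
  note cA = charts_atD[OF c]
  have "snd c p \<in> snd c ` fst c" using cA by simp
  then obtain r where r: "r > 0" "cball (snd c p) r \<subseteq> snd c ` fst c"
    using open_chart_image[OF cA(1)] open_contains_cball by metis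
  obtain \<rho> :: "'e \<Rightarrow> real" where \<rho>: "smooth_on UNIV \<rho>" "\<rho> (snd c p) \<noteq> 0"
    "\<And>x. x \<notin> cball (snd c p) r \<Longrightarrow> \<rho> x = 0"
    using smooth_bump_exists[OF r(1)] by blast
  let ?K = "chart_inv c ` cball (snd c p) r"
  have "compactin (top_of_set (snd c ` fst c)) (cball (snd c p) r)"
    using r(2) by (simp add: compactin_subtopology compactin_euclidean_iff)
  from image_compactin[OF this continuous_map_chart_inv[OF cA(1)]]
  have "closedin (atlas_topology A) ?K" using H by (rule compactin_imp_closedin[rotated])
  moreover have "?K \<subseteq> fst c" using r(2) chart_inv_mem[of _ c] by blast
  moreover have "\<rho> (snd c q) = 0" if "q \<in> fst c" "q \<notin> ?K" for q
  proof (rule \<rho>(3))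
    show "snd c q \<notin> cball (snd c p) r" using that chart_inv_chart[OF cA(1) that(1)] by (metis image_eqI)
  qed
  ultimately show ?thesis by (intro that[OF \<rho>(1,2)]) auto
qed

text \<open>The cutoff depends on the base point only, so one bump on M serves all fibres at
  once.\<close>

definition vertical_field :: "('a, 'e) chart \<Rightarrow> ('e \<Rightarrow> real) \<Rightarrow> 'e \<Rightarrow> ('a, 'e) tm \<Rightarrow> ('a, 'e) ttm" where
  "vertical_field c \<rho> b q = (\<lambda>C. if fst q \<in> fst c
     then \<rho> (snd c (fst q)) *\<^sub>R coord_vector (tangent_bundle A) (tangent_chart c) q (0, b) C else 0)"

lemma vertical_field_coord:
  assumes q: "(p, v) \<in> carrier (tangent_bundle A)" and c: "c \<in> charts_at A p" and d: "d \<in> charts_at A p"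
  shows "vertical_field c \<rho> b (p, v) (tangent_chart d)
    = (0, \<rho> (snd c p) *\<^sub>R frechet_derivative (transition c d) (at (snd c p)) b)"
proof -
  note v = tangent_bundle_carrierD(2)[OF q]
  note cA = charts_atD(1)[OF c] and dA = charts_atD(1)[OF d]
  \<comment> \<open>The second derivatives of the transition act on the base component, which is 0
    here.\<close>
  have "frechet_derivative (\<lambda>x. frechet_derivative (transition c d) (at x) (v c)) (at (snd c p)) 0 = 0"
    by (rule linear_0[OF smooth_on_linear_derivative[OF smooth_on_frechet_derivative[OF smooth_on_transition[OF cA dA]]
      charts_at_overlap[OF c d]]])
  then show ?thesis
    unfolding vertical_field_def TB.coord_vector_apply[OF tangent_chart_charts_at[OF v d]]
      tangent_chart_apply transition_tangent_chart_derivative[OF c d] fst_conv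
    using charts_atD(2)[OF c] linear_0[OF linear_transition_derivative[OF c d]] by simp
qed

lemma vertical_field_outside: "p \<notin> fst c \<Longrightarrow> vertical_field c \<rho> b (p, v) = (\<lambda>C. 0)"
  by (simp add: vertical_field_def)

text \<open>Smoothness is local, and two open sets cover the image of any chart \<open>d\<close>:
  the overlap with \<open>c\<close>, where the coordinate formula applies, and the part outside
  \<open>K\<close>, where the field is 0.\<close>

lemma vector_field_vertical_field:
  assumes c: "c \<in> A" and \<rho>: "smooth_on UNIV \<rho>" and K: "closedin (atlas_topology A) K" "K \<subseteq> fst c"
    and supp: "\<forall>r\<in>fst c - K. \<rho> (snd c r) = 0"
  shows "vector_field (tangent_bundle A) (vertical_field c \<rho> b)"
  unfolding vector_field_def
proof (intro conjI ballI)
  fix q assume "q \<in> carrier (tangent_bundle A)"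
  then obtain p v where q: "q = (p, v)" "v \<in> tangent_space A p"
    by (cases q) (simp add: mem_carrier_tangent_bundle)
  show "vertical_field c \<rho> b q \<in> tangent_space (tangent_bundle A) q"
  proof (cases "p \<in> fst c")
    case True
    then show ?thesis
      using TB.tangent_space_scale[OF TB.coord_vector_mem[OF tangent_chart_charts_at[OF q(2) charts_atI[OF c True]]]]
      by (simp add: vertical_field_def q)
  next
    case False
    then show ?thesis using TB.zero_mem_tangent_space by (simp add: q vertical_field_outside)
  qed
next
  fix C assume "C \<in> tangent_bundle A"
  then obtain d where d: "d \<in> A" and C: "C = tangent_chart d" by (auto simp: tangent_bundle_eq)
  have "smooth_on (snd d ` fst d \<times> UNIV) (\<lambda>z. vertical_field c \<rho> b (chart_inv (tangent_chart d) z) (tangent_chart d))"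
  proof (rule smooth_on_local)
    fix z assume "z \<in> snd d ` fst d \<times> (UNIV :: 'e set)"
    then obtain r where r: "r \<in> fst d" "fst z = snd d r" by auto
    show "\<exists>T. open T \<and> z \<in> T \<and> smooth_on T (\<lambda>z. vertical_field c \<rho> b (chart_inv (tangent_chart d) z) (tangent_chart d))"
    proof (cases "r \<in> K")
      case True
      let ?V = "snd d ` (fst d \<inter> fst c)"
      have V: "open (?V \<times> (UNIV :: 'e set))" by (intro open_Times open_overlap_image c d open_UNIV)
      have tr: "smooth_on (?V \<times> (UNIV :: 'e set)) (\<lambda>z. transition d c (fst z))"
        by (rule smooth_on_compose[OF V smooth_on_fst smooth_on_transition[OF d c]]) auto
      have im: "(\<lambda>z. transition d c (fst z)) ` (?V \<times> (UNIV :: 'e set)) \<subseteq> snd c ` (fst c \<inter> fst d)"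
        using chart_inv_chart[OF d] by auto
      have "smooth_on (?V \<times> UNIV) (\<lambda>z. vertical_field c \<rho> b (chart_inv (tangent_chart d) z) (tangent_chart d))"
      proof (rule smooth_on_cong[OF V])
        \<comment> \<open>Bump and vector are given in the coordinates of \<open>c\<close>, so a
          point given in \<open>d\<close> is first sent back to \<open>c\<close>; the derivative of
          the reverse transition returns the vector to \<open>d\<close>.\<close>
        show "smooth_on (?V \<times> (UNIV :: 'e set)) (\<lambda>z. (0 :: 'e, \<rho> (transition d c (fst z)) *\<^sub>R
            frechet_derivative (transition c d) (at (transition d c (fst z))) b))"
          by (intro smooth_on_Pair smooth_on_const smooth_on_scaleR V smooth_on_compose[OF V tr \<rho>]
              smooth_on_compose[OF V tr smooth_on_frechet_derivative[OF smooth_on_transition[OF c d]] im]) simp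
        fix z assume z: "z \<in> ?V \<times> (UNIV :: 'e set)"
        then have "z \<in> snd d ` fst d \<times> UNIV" by auto
        then obtain p v where p: "d \<in> charts_at A p" "(p, v) \<in> carrier (tangent_bundle A)" "z = (snd d p, v d)"
          "chart_inv (tangent_chart d) z = (p, v)" using tangent_chart_point[OF d] by metis
        have "p \<in> fst c" using z p(1,3) chart_inv_chart[OF d] charts_atD[OF p(1)] by auto metis
        then have cp: "c \<in> charts_at A p" by (rule charts_atI[OF c])
        have dc: "transition d c (fst z) = snd c p"
          using transition_chart[OF charts_atD[OF p(1)], of c] p(3) by simp
        show "(0, \<rho> (transition d c (fst z)) *\<^sub>R frechet_derivative (transition c d) (at (transition d c (fst z))) b)
          = vertical_field c \<rho> b (chart_inv (tangent_chart d) z) (tangent_chart d)"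
          unfolding p(4) vertical_field_coord[OF p(2) cp p(1)] dc ..
      qed
      moreover have "z \<in> ?V \<times> UNIV" using r True K(2) by (cases z) auto
      ultimately show ?thesis using V by blast
    next
      case False
      let ?V = "snd d ` ((carrier A - K) \<inter> fst d)"
      have "openin (atlas_topology A) (carrier A - K)"
        using openin_diff[OF openin_topspace K(1)] by (simp add: topspace_atlas_topology)
      then have V: "open (?V \<times> (UNIV :: 'e set))"
        using d by (intro open_Times open_UNIV) (simp add: openin_atlas_topology[OF A])
      have "smooth_on (?V \<times> UNIV) (\<lambda>z. vertical_field c \<rho> b (chart_inv (tangent_chart d) z) (tangent_chart d))"
      proof (rule smooth_on_cong[OF V smooth_on_const[of _ 0]])
        fix z assume z: "z \<in> ?V \<times> (UNIV :: 'e set)"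
        then obtain x y where "z = (x, y)" "x \<in> ?V" by auto
        then obtain p where p: "x = snd d p" "p \<notin> K" "p \<in> fst d" by auto
        have "chart_inv (tangent_chart d) z = (p, coord_vector A d p y)"
          using chart_inv_tangent_chart[OF d, of x y] p \<open>z = (x, y)\<close> chart_inv_chart[OF d p(3)] by simp
        \<comment> \<open>A point outside \<open>K\<close> lies either outside \<open>fst c\<close>,
          where the field is 0 by definition, or in \<open>fst c\<close>, where the bump is
          0.\<close>
        then show "0 = vertical_field c \<rho> b (chart_inv (tangent_chart d) z) (tangent_chart d)"
          using supp p(2) by (simp add: vertical_field_def)
      qed
      moreover have "z \<in> ?V \<times> UNIV" using r False d by (cases z) (auto simp: carrier_def)
      ultimately show ?thesis using V by blast
    qed
  qed
  then show "smooth_on (snd C ` fst C) (\<lambda>z. vertical_field c \<rho> b (chart_inv C z) C)"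
    by (simp add: C image_tangent_chart[OF d])
qed

lemma vector_field_add:
  assumes "vector_field A X" "vector_field A Y"
  shows "vector_field A (\<lambda>p c. X p c + Y p c)"
  using assms unfolding vector_field_def
  by (auto intro!: tangent_space_add smooth_on_add open_chart_image)

end

context metric_atlas
begin

interpretation TB: atlas "tangent_bundle A"
  by unfold_locales (rule smooth_atlas_tangent_bundle)

text \<open>The work form 0 yields the geodesic field of \<open>g\<close>.\<close>

lemma second_order_de_exists: "\<exists>D. second_order_de A D"
proof -
  have "one_form (tangent_bundle A) (\<lambda>q w. 0)" by (simp add: one_form_def covector_def)
  moreover from this have "horizontal A (\<lambda>q w. 0)" by (rule horizontalI) simp
  ultimately show ?thesis using second_order_de_dynamics by blast
qed

text \<open>A second order equation stays one when a vertical field is added, and by means of a bump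
  function every vertical vector is a multiple of a value of such a field.\<close>

lemma contact_horizontal:
  assumes H: "Hausdorff_space (atlas_topology A)" and \<alpha>: "\<alpha> \<in> contact_system A"
  shows "horizontal A \<alpha>"
proof (rule horizontalI)
  show one: "one_form (tangent_bundle A) \<alpha>" using \<alpha> by (simp add: contact_system_def)
  have kill: "\<alpha> q (D q) = 0" if "second_order_de A D" "q \<in> carrier (tangent_bundle A)" for D q
    using \<alpha> that by (simp add: contact_system_def)
  fix p v c b
  assume q: "(p, v) \<in> carrier (tangent_bundle A)" and c: "c \<in> charts_at A p"
  note v = tangent_bundle_carrierD(2)[OF q] and cA = charts_atD[OF c]
  obtain \<rho> :: "'e \<Rightarrow> real" and K where \<rho>: "smooth_on UNIV \<rho>" "\<rho> (snd c p) \<noteq> 0" and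
    K: "closedin (atlas_topology A) K" "K \<subseteq> fst c" "\<forall>r\<in>fst c - K. \<rho> (snd c r) = 0"
    by (rule manifold_bump[OF H c])
  obtain D where D: "second_order_de A D" using second_order_de_exists by blast
  define Y where "Y = vertical_field c \<rho> b"
  have Y: "vector_field (tangent_bundle A) Y"
    unfolding Y_def by (rule vector_field_vertical_field[OF cA(1) \<rho>(1) K])
  have "second_order_de A (\<lambda>q C. D q C + Y q C)"
  proof (rule second_order_deI)
    show "vector_field (tangent_bundle A) (\<lambda>q C. D q C + Y q C)"
      using D Y by (intro TB.vector_field_add) (simp_all add: second_order_de_def)
    fix p v assume q: "(p, v) \<in> carrier (tangent_bundle A)"
    obtain d where d: "d \<in> charts_at A p" using chart_of_mem[OF tangent_bundle_carrierD(1)[OF q]] by blast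
    have "fst (Y (p, v) (tangent_chart d)) = 0"
    proof (cases "p \<in> fst c")
      case True
      then show ?thesis using vertical_field_coord[OF q charts_atI[OF cA(1)] d] by (simp add: Y_def)
    qed (simp add: Y_def vertical_field_outside)
    then show "\<exists>d\<in>charts_at A p. fst (D (p, v) (tangent_chart d) + Y (p, v) (tangent_chart d)) = v d"
      using second_order_deD[OF D q d] d by (intro bexI[of _ d]) simp_all
  qed
  from kill[OF this q] have "\<alpha> (p, v) (\<lambda>C. D (p, v) C + Y (p, v) C) = 0" .
  moreover have cov: "covector (tangent_bundle A) (p, v) (\<alpha> (p, v))" using one q by (simp add: one_form_def)
  moreover have "D (p, v) \<in> tangent_space (tangent_bundle A) (p, v)" "Y (p, v) \<in> tangent_space (tangent_bundle A) (p, v)"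
    using D Y q by (simp_all add: second_order_de_def vector_field_def)
  ultimately have "\<alpha> (p, v) (Y (p, v)) = 0"
    using kill[OF D q] by (simp add: covector_def)
  moreover have "Y (p, v) = (\<lambda>C. \<rho> (snd c p) *\<^sub>R coord_vector (tangent_bundle A) (tangent_chart c) (p, v) (0, b) C)"
    using cA(2) by (simp add: Y_def vertical_field_def)
  ultimately show "\<alpha> (p, v) (coord_vector (tangent_bundle A) (tangent_chart c) (p, v) (0, b)) = 0"
    using cov TB.coord_vector_mem[OF tangent_chart_charts_at[OF v c], of "(0, b)"] \<rho>(2)
    by (simp add: covector_def)
qed

end

section \<open>The two inclusions\<close>

lemma symplectic_form_self: "symplectic_form A g q w w = 0"
  by (simp add: symplectic_form_def exterior_derivative_def Let_def)

lemma horizontal_second_order_de_eq: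
  assumes "horizontal A \<alpha>" "second_order_de A D" "second_order_de A D'" "q \<in> carrier (tangent_bundle A)"
  shows "\<alpha> q (D q) = \<alpha> q (D' q)"
proof -
  obtain p v where q: "q = (p, v)" by fastforce
  obtain \<beta> where \<beta>: "\<And>w. w \<in> tangent_space (tangent_bundle A) (p, v) \<Longrightarrow>
      \<alpha> (p, v) w = \<beta> (tangent_map (tangent_bundle A) A fst (p, v) w)"
    using assms(1,4) unfolding horizontal_def q by force
  have "D (p, v) \<in> tangent_space (tangent_bundle A) (p, v)" "D' (p, v) \<in> tangent_space (tangent_bundle A) (p, v)"
    "tangent_map (tangent_bundle A) A fst (p, v) (D (p, v)) = v" "tangent_map (tangent_bundle A) A fst (p, v) (D' (p, v)) = v"
    using assms(2-4) by (auto simp: second_order_de_def vector_field_def q)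
  then show ?thesis by (simp add: q \<beta>)
qed

theorem corollary4p3:
  fixes A :: "('a, 'e::euclidean_space) chart set"
    and g :: "'a \<Rightarrow> ('a, 'e) tangent \<Rightarrow> ('a, 'e) tangent \<Rightarrow> real"
  assumes "smooth_manifold A"
    and "pseudo_riemannian_metric A g"
  shows "{\<alpha>. \<exists>D. relativistic_field A g D \<and> work_form A g D \<alpha>} = contact_system A"
proof (intro equalityI subsetI)
  interpret metric_atlas A g
    using assms by unfold_locales (simp_all add: smooth_manifold_def)
  have work_self: "differential (tangent_bundle A) (kinetic_energy g) q (D q) + \<alpha> q (D q) = 0"
    if "work_form A g D \<alpha>" "second_order_de A D" "q \<in> carrier (tangent_bundle A)" for D \<alpha> q
    using that symplectic_form_self[of A g q "D q"]
    by (force simp: work_form_def second_order_de_def vector_field_def)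
  {
    fix \<alpha> assume "\<alpha> \<in> {\<alpha>. \<exists>D. relativistic_field A g D \<and> work_form A g D \<alpha>}"
    then obtain D where D: "relativistic_field A g D" "work_form A g D \<alpha>" by blast
    then have "\<alpha> q (D q) = 0" if "q \<in> carrier (tangent_bundle A)" for q
      using work_self[OF D(2) _ that] that by (simp add: relativistic_field_def)
    then show "\<alpha> \<in> contact_system A"
      using D horizontal_second_order_de_eq[of A \<alpha> _ D]
      by (simp add: contact_system_def relativistic_field_def work_form_def)
  next
    fix \<alpha> assume \<alpha>: "\<alpha> \<in> contact_system A"
    have one: "one_form (tangent_bundle A) \<alpha>" using \<alpha> by (simp add: contact_system_def)
    have hor: "horizontal A \<alpha>"
      using assms(1) \<alpha> by (intro contact_horizontal) (simp_all add: smooth_manifold_def)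
    note D = second_order_de_dynamics[OF one hor] and w = work_form_dynamics[OF one hor]
    \<comment> \<open>A contact form annihilates in particular the second order equation that it
      generates as a work form.\<close>
    have "relativistic_field A g (dynamics \<alpha>)"
      using D work_self[OF w D] \<alpha> by (simp add: relativistic_field_def contact_system_def)
    then show "\<alpha> \<in> {\<alpha>. \<exists>D. relativistic_field A g D \<and> work_form A g D \<alpha>}" using w by blast
  }
qed

end
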